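(* Let $\tau\in\mathbb{C}$ with $\operatorname{Im}(\tau)>0$ and $q=e^{2\pi i\tau}$. Then the following eight identities hold: (1) $\displaystyle \frac{\eta(2\tau)^5}{\eta(\tau)^2\,\eta(4\tau)^2}=\sum_{n=-\infty}^{\infty}q^{n^2}$; (2) $\displaystyle \frac{\eta(8\tau)\,\eta(32\tau)}{\eta(16\tau)}=\sum_{n=1}^{\infty}\left(\frac{2}{n}\right)q^{n^2}$; (3) $\displaystyle \frac{\eta(16\tau)^2}{\eta(8\tau)}=\sum_{n=1}^{\infty}\left(\frac{n}{2}\right)^2q^{n^2}$; (4) $\displaystyle \frac{\eta(6\tau)^2\,\eta(9\tau)\,\eta(36\tau)}{\eta(3\tau)\,\eta(12\tau)\,\eta(18\tau)}=\sum_{n=1}^{\infty}\left(\frac{n}{3}\right)^2q^{n^2}$; (5) $\displaystyle \eta(24\tau)=\sum_{n=1}^{\infty}\left(\frac{12}{n}\right)q^{n^2}$; (6) $\displaystyle \frac{\eta(48\tau)^3}{\eta(24\tau)\,\eta(96\tau)}=\sum_{n=1}^{\infty}\left(\frac{24}{n}\right)q^{n^2}$; (7) $\displaystyle \frac{\eta(48\tau)\,\eta(72\tau)^2}{\eta(24\tau)\,\eta(144\tau)}=\sum_{n=1}^{\infty}\left(\frac{n}{6}\right)^2q^{n^2}$; (8) $\displaystyle \frac{\eta(24\tau)\,\eta(96\tau)\,\eta(144\tau)^5}{\eta(48\tau)^2\,\eta(72\tau)^2\,\eta(288\tau)^2}=\sum_{n=1}^{\infty}\left(\frac{18}{n}\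right)q^{n^2}$.
   Context: For $\operatorname{Im}(\tau)>0$ and $q=e^{2\pi i\tau}$, Dedekind's eta function is $\eta(\tau)=q^{1/24}\prod_{n=1}^{\infty}(1-q^n)$, where $q^{1/24}=e^{2\pi i\tau/24}$; $\eta(k\tau)^j$ denotes the $j$-th power of $\eta(k\tau)$. The symbol $\left(\frac{a}{m}\right)$, for an integer $a$ and a positive integer $m$, is the Kronecker symbol: $\left(\frac{a}{1}\right)=1$; for an odd prime $p$, $\left(\frac{a}{p}\right)$ is the Legendre symbol ($0$ if $p\mid a$, $1$ if $a$ is a nonzero quadratic residue mod $p$, $-1$ otherwise); $\left(\frac{a}{2}\right)=0$ if $a$ is even, $1$ if $a\equiv\pm1\pmod 8$, $-1$ if $a\equiv\pm3\pmod 8$; and $\left(\frac{a}{m}\right)=\prod_{i=1}^{s}\left(\frac{a}{p_i}\right)$ if $m=\prod_{i=1}^{s}p_i$ is the factorization of $m$ into primes (with repetition). *)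

theory Defs
  imports "HOL-Analysis.Analysis" "HOL-Number_Theory.Number_Theory"
begin

definition dedekind_eta :: "complex \<Rightarrow> complex" where
  "dedekind_eta \<tau> =
     exp (2 * of_real pi * \<i> * \<tau> / 24) *
     (\<Prod>n. 1 - exp (2 * of_real pi * \<i> * \<tau>) ^ Suc n)"

text \<open>The symbol \<open>(a/p)\<close>, intended for prime \<open>p\<close> only.\<close>

definition kronecker_prime :: "int \<Rightarrow> nat \<Rightarrow> int" where
  "kronecker_prime a p =
     (if p = 2
      then (if even a then 0 else if [a = 1] (mod 8) \<or> [a = - 1] (mod 8) then 1 else - 1)
      else Legendre a (int p))"

text \<open>The symbol \<open>(a/m)\<close> for \<open>m > 0\<close>; at \<open>m = 0\<close> the value is the junk value \<open>1\<close>.\<close>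

definition kronecker :: "int \<Rightarrow> nat \<Rightarrow> int" where
  "kronecker a m = (\<Prod>p\<in>#prime_factorization m. kronecker_prime a p)"

end

theory Submission
  imports Defs
begin

text \<open>
  Apart from (1), which is \<open>f(q, q)\<close> in the notation below, each right-hand side is a two-sided
  theta series in disguise: the squares that carry a nonzero coefficient
  are exactly the \<open>(c n - 1)\<^sup>2\<close> with \<open>n\<close> ranging over the integers and \<open>c\<close> one of \<open>3\<close>, \<open>4\<close>, \<open>6\<close>,
  and the coefficient is a sign that is periodic in \<open>n\<close>. Hence it is, up to the factor \<open>q\<close>, an
  instance of Ramanujan's
  \<open>f(a, b) = \<Sum>n. a\<^bsup>n(n+1)/2\<^esup> b\<^bsup>n(n-1)/2\<^esup>\<close> with \<open>a\<close>, \<open>b\<close> signed powers of \<open>q\<close>. The Jacobi triple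
  product turns \<open>f(a, b)\<close> into infinite products that regroup into eta quotients. The signs are
  recognised as Kronecker symbols via the quadratic characters of \<open>2\<close> and \<open>3\<close>.
\<close>

section \<open>Infinite products and the Jacobi triple product\<close>

text \<open>The q-Pochhammer symbol \<open>(a; p)_\<infinity>\<close>, with base \<open>p\<close>
  and exponents starting at 0.\<close>

definition qpoch :: "complex \<Rightarrow> complex \<Rightarrow> complex" where
  "qpoch a p = (\<Prod>n. 1 - a * p ^ n)"

lemma summable_norm_geometric:
  fixes a p :: complex
  assumes "norm p < 1"
  shows "summable (\<lambda>n. norm (a * p ^ n))"
  using summable_mult[OF summable_geometric[of "norm p"], of "norm a"] assms
  by (simp add: norm_mult norm_power)

lemma abs_convergent_prod_qpoch:
  fixes a p :: complex
  assumes "norm p < 1"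
  shows "abs_convergent_prod (\<lambda>n. 1 - a * p ^ n)"
  using summable_norm_geometric[OF assms, of a]
  by (simp add: abs_convergent_prod_conv_summable norm_minus_commute)

lemma has_prod_qpoch:
  assumes "norm p < 1"
  shows "(\<lambda>n. 1 - a * p ^ n) has_prod qpoch a p"
  unfolding qpoch_def
  by (intro convergent_prod_has_prod abs_convergent_prod_imp_convergent_prod
      abs_convergent_prod_qpoch assms)

lemma qpoch_partial_products_LIMSEQ:
  assumes "norm p < 1"
  shows "(\<lambda>n. \<Prod>k<n. 1 - a * p ^ k) \<longlonglongrightarrow> qpoch a p"
  using has_prod_imp_tendsto'[OF has_prod_qpoch[OF assms]] by simp

lemma qpoch_factor_nonzero:
  fixes a p :: complex
  assumes "norm p < 1" "norm a < 1"
  shows "1 - a * p ^ n \<noteq> 0"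
proof
  assume "1 - a * p ^ n = 0"
  hence "norm (a * p ^ n) = 1"
    by (metis eq_iff_diff_eq_0 norm_one)
  moreover have "norm (a * p ^ n) \<le> norm a * 1"
    unfolding norm_mult norm_power
    by (intro mult_left_mono power_le_one) (use assms in auto)
  ultimately show False using assms by simp
qed

lemma qpoch_nonzero:
  assumes "norm p < 1" "norm a < 1"
  shows "qpoch a p \<noteq> 0"
  unfolding has_prod_eq_0_iff[OF has_prod_qpoch[OF assms(1)]]
  using qpoch_factor_nonzero[OF assms, symmetric] by (auto simp del: right_minus_eq)

section \<open>Ramanujan's theta series and the Jacobi triple product\<close>

text \<open>The summand of \<open>f(a, b)\<close>. Both exponents are triangular numbers, hence
  nonnegative for every integer \<open>j\<close>; \<open>powi\<close> lets them stay of type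
  \<open>int\<close>.\<close>

definition theta_term :: "complex \<Rightarrow> complex \<Rightarrow> int \<Rightarrow> complex" where
  "theta_term a b j = a powi (j * (j + 1) div 2) * b powi (j * (j - 1) div 2)"

lemma theta_term_plus1:
  assumes "a \<noteq> 0" "b \<noteq> 0"
  shows "theta_term a b (j + 1) = theta_term a b j * a * (a * b) powi j"
proof -
  have 1: "(j + 1) * (j + 1 + 1) div 2 = j * (j + 1) div 2 + (j + 1)"
  proof -
    have "(j + 1) * (j + 1 + 1) = j * (j + 1) + (j + 1) * 2" by (simp add: algebra_simps)
    thus ?thesis by simp
  qed
  have 2: "(j + 1) * (j + 1 - 1) div 2 = j * (j - 1) div 2 + j"
  proof -
    have "(j + 1) * (j + 1 - 1) = j * (j - 1) + j * 2" by (simp add: algebra_simps)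
    thus ?thesis by simp
  qed
  show ?thesis
    unfolding theta_term_def 1 2
    using assms by (simp add: power_int_add power_int_mult_distrib)
qed

text \<open>The reflection \<open>j \<mapsto> - j\<close> exchanges the two triangular exponents.
  Through it, statements about negative indices follow from those about nonnegative ones.\<close>

lemma theta_term_uminus: "theta_term a b (- j) = theta_term b a j"
proof -
  have "- j * (- j + 1) = j * (j - 1)" "- j * (- j - 1) = j * (j + 1)"
    by (simp_all add: algebra_simps)
  thus ?thesis
    by (simp add: theta_term_def mult.commute)
qed

lemma theta_term_minus1:
  assumes "a \<noteq> 0" "b \<noteq> 0"
  shows "theta_term a b (j - 1) = theta_term a b j * b * (a * b) powi (- j)"
proof -
  have "theta_term a b (- (- j + 1)) = theta_term b a (- j) * b * (b * a) powi (- j)"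
    by (subst theta_term_uminus, rule theta_term_plus1) (use assms in auto)
  thus ?thesis
    by (simp add: theta_term_uminus mult.commute)
qed

lemma has_sum_int_shift:
  fixes f :: "int \<Rightarrow> 'a :: {comm_monoid_add, topological_space}"
  shows "((\<lambda>j. f (j + c)) has_sum S) UNIV \<longleftrightarrow> (f has_sum S) UNIV"
  by (rule has_sum_reindex_bij_betw) (rule bij_betwI[of _ _ _ "\<lambda>j. j - c"], auto)

text \<open>The polynomial core of the induction step for the finite triple product. There
  \<open>i\<close> is \<open>inverse p\<close>, but the identity holds for free \<open>i\<close>, so
  plain ring arithmetic proves it.\<close>

lemma triple_product_step_identity:
  fixes U V i :: "'a :: comm_ring_1"
  shows "P * ((1 - U * V * i) * (1 - U * V)) * R * S * t =
       (1 + U * V * i) * (P * ((1 - U) * R) * ((1 - V) * S) * t) +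
         V * t * (P * ((1 - U * i) * (1 - U) * R) * S) +
         U * t * (P * R * ((1 - V * i) * (1 - V) * S))"
  by (simp add: algebra_simps)

text \<open>
  Finite form of the triple product. With \<open>r\<close> extended by \<open>0\<close> to negative integers, the relation
  \<open>r (k - 1) = (1 - p\<^bsup>k\<^esup>) * r k\<close> holds for all integers \<open>k\<close>, so the induction on \<open>N\<close> needs no
  boundary terms.
\<close>

lemma finite_triple_product:
  fixes a b :: complex
  assumes ab: "a \<noteq> 0" "b \<noteq> 0" and p: "p = a * b" "norm p < 1"
  defines "P \<equiv> \<lambda>n. \<Prod>i<n. 1 - p * p ^ i"
  defines "r \<equiv> \<lambda>k::int. if k < 0 then 0 else inverse (P (nat k))"
  shows "((\<lambda>j. P (2 * N) * r (int N + j) * r (int N - j) * theta_term a b j) has_sum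
           (\<Prod>k<N. (1 + a * p ^ k) * (1 + b * p ^ k))) UNIV"
proof (induction N)
  case 0
  have "((\<lambda>j. P (2 * 0) * r (int 0 + j) * r (int 0 - j) * theta_term a b j) has_sum 1) UNIV"
    by (rule has_sum_finite_neutralI[of "{0}"]) (auto simp: r_def P_def theta_term_def)
  thus ?case by simp
next
  case (Suc N)
  let ?T = "theta_term a b"
  have p0: "p \<noteq> 0" using ab p by simp
  define c where "c = (\<lambda>j. P (2 * N) * r (int N + j) * r (int N - j))"
  have IH: "((\<lambda>j. c j * ?T j) has_sum (\<Prod>k<N. (1 + a * p ^ k) * (1 + b * p ^ k))) UNIV"
    using Suc.IH by (simp add: c_def)
  have P_Suc: "P (Suc n) = P n * (1 - p ^ Suc n)" for n
    by (simp add: P_def)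
  \<comment> \<open>The boundary case is \<open>k = 0\<close>: the factor
    \<open>1 - p powi 0\<close> vanishes, in agreement with \<open>r (- 1) = 0\<close>.\<close>
  have r_minus1: "r (k - 1) = (1 - p powi k) * r k" for k
  proof (cases "k > 0")
    case True
    then obtain n where n: "k = int (Suc n)"
      by (metis gr0_implies_Suc zero_less_imp_eq_int)
    have "1 - p ^ Suc n \<noteq> 0"
      using qpoch_factor_nonzero[of p p n] p by simp
    moreover have "nat k = Suc n" "nat (k - 1) = n" "p powi k = p ^ Suc n"
      using n by (auto simp: power_int_def nat_add_distrib)
    ultimately show ?thesis
      using n by (simp add: r_def P_Suc del: power_Suc)
  qed (auto simp: r_def)
  \<comment> \<open>A three-term recurrence of q-Pascal type. It mirrors multiplication by
    \<open>(1 + a * p ^ N) * (1 + b * p ^ N)\<close>, in which \<open>a * b = p\<close> gives the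
    constant part \<open>1 + p * p ^ (2 * N)\<close>.\<close>
  have step: "P (2 * Suc N) * r (int (Suc N) + j) * r (int (Suc N) - j) * ?T j =
      (1 + p * p ^ (2 * N)) * (c j * ?T j) + a * p ^ N * (c (j - 1) * ?T (j - 1)) +
      b * p ^ N * (c (j + 1) * ?T (j + 1))" for j
  proof -
    \<comment> \<open>All values of \<open>r\<close> are reduced to those at the largest arguments
      \<open>N + 1 + j\<close> and \<open>N + 1 - j\<close>; what remains is polynomial in
      \<open>U\<close>, \<open>V\<close> and \<open>inverse p\<close>.\<close>
    define U V where "U = p powi (int N + 1 + j)" and "V = p powi (int N + 1 - j)"
    define R S where "R = r (int N + 1 + j)" and "S = r (int N + 1 - j)"
    define w where "w = p ^ (2 * N)"
    have UV: "U * V = w * p * p"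
    proof -
      have "U * V = p powi (int (2 * N + 2))"
        unfolding U_def V_def using p0 by (simp flip: power_int_add add: add.commute)
      also have "\<dots> = p ^ (2 * N + 2)"
        by (simp only: power_int_of_nat)
      finally show ?thesis by (simp add: w_def)
    qed
    have up: "p powi (int N + j) = U / p" "p powi (int N - j) = V / p"
      using p0 by (auto simp: U_def V_def power_int_add power_int_diff field_simps)
    have r1: "r (int N + j) = (1 - U) * R" "r (int N - j) = (1 - V) * S"
      using r_minus1[of "int N + 1 + j"] r_minus1[of "int N + 1 - j"]
      by (simp_all add: U_def V_def R_def S_def algebra_simps)
    have r2: "r (int N + (j - 1)) = (1 - U / p) * (1 - U) * R"
      "r (int N - (j + 1)) = (1 - V / p) * (1 - V) * S"
      using r_minus1[of "int N + j"] r_minus1[of "int N - j"]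
      by (simp_all add: up r1 mult.assoc add_diff_eq diff_diff_eq)
    have r3: "r (int N - (j - 1)) = S" "r (int N + (j + 1)) = R"
      by (simp_all add: R_def S_def algebra_simps)
    have T1: "a * p ^ N * ?T (j - 1) = V * ?T j"
      unfolding theta_term_minus1[OF ab] V_def p(1)[symmetric]
      using p0 by (simp add: power_int_add power_int_diff power_int_minus p(1) field_simps)
    have T2: "b * p ^ N * ?T (j + 1) = U * ?T j"
      unfolding theta_term_plus1[OF ab] U_def p(1)[symmetric]
      using p0 by (simp add: power_int_add p(1) field_simps)
    have PP: "P (2 * Suc N) = P (2 * N) * (1 - w * p) * (1 - w * p * p)"
      by (simp add: P_def w_def mult_ac)
    have c: "c j = P (2 * N) * ((1 - U) * R) * ((1 - V) * S)"
      "c (j - 1) = P (2 * N) * ((1 - U / p) * (1 - U) * R) * S"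
      "c (j + 1) = P (2 * N) * R * ((1 - V / p) * (1 - V) * S)"
      unfolding c_def r1 r2 r3 by (rule refl)+
    have w: "w * p = U * V * inverse p" "w * p * p = U * V"
      using UV p0 by (auto simp: field_simps)
    have "P2 * ((1 - w * p) * (1 - w * p * p)) * R * S * t =
       (1 + w * p) * (P2 * ((1 - U) * R) * ((1 - V) * S) * t) +
         V * t * (P2 * ((1 - U / p) * (1 - U) * R) * S) +
         U * t * (P2 * R * ((1 - V / p) * (1 - V) * S))" for P2 t
      unfolding w(2) unfolding w(1) divide_inverse
      by (rule triple_product_step_identity)
    from this[of "P (2 * N)" "?T j"] show ?thesis
      unfolding c[symmetric] T1[symmetric] T2[symmetric] PP
      by (simp add: R_def S_def w_def mult_ac add_ac)
  qed
  define X where "X = (\<Prod>k<N. (1 + a * p ^ k) * (1 + b * p ^ k))"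
  have "((\<lambda>j. (1 + p * p ^ (2 * N)) * (c j * ?T j) + a * p ^ N * (c (j - 1) * ?T (j - 1)) +
      b * p ^ N * (c (j + 1) * ?T (j + 1))) has_sum
      ((1 + p * p ^ (2 * N)) * X + a * p ^ N * X + b * p ^ N * X)) UNIV"
    \<comment> \<open>Shifting the index by one does not change a sum over all integers, so each of
      the three pieces contributes a multiple of \<open>X\<close>.\<close>
    using has_sum_int_shift[of "\<lambda>j. c j * ?T j" "-1"] has_sum_int_shift[of "\<lambda>j. c j * ?T j" 1] IH
    by (intro has_sum_add has_sum_cmult_right) (auto simp: X_def)
  moreover have "(1 + p * p ^ (2 * N)) * X + a * p ^ N * X + b * p ^ N * X =
      (\<Prod>k<Suc N. (1 + a * p ^ k) * (1 + b * p ^ k))"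
  proof -
    have "(1 + p * (u * u)) * X + a * u * X + b * u * X = X * ((1 + a * u) * (1 + b * u))" for u
      unfolding p(1) by (simp add: algebra_simps)
    from this[of "p ^ N"] show ?thesis
      by (simp add: X_def mult_2 power_add)
  qed
  ultimately show ?case
    by (simp only: step)
qed

text \<open>Ratio test: consecutive terms differ by the factor \<open>a * (a * b) ^ n\<close>, which
  tends to 0 even if \<open>a\<close> itself is large.\<close>

lemma theta_term_summable_nat:
  assumes ab: "a \<noteq> 0" "b \<noteq> 0" and p: "norm (a * b) < 1"
  shows "summable (\<lambda>n. norm (theta_term a b (int n)))"
proof -
  have "(\<lambda>n. norm a * norm (a * b) ^ n) \<longlonglongrightarrow> norm a * 0"
    by (intro tendsto_intros LIMSEQ_power_zero) (use p in auto)
  hence "eventually (\<lambda>n. norm a * norm (a * b) ^ n < 1 / 2) sequentially"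
    by (rule order_tendstoD) auto
  then obtain N where N: "\<And>n. n \<ge> N \<Longrightarrow> norm a * norm (a * b) ^ n < 1 / 2"
    by (auto simp: eventually_sequentially)
  show ?thesis
  proof (rule summable_ratio_test[of "1 / 2" N])
    fix n assume "n \<ge> N"
    have "norm (theta_term a b (int (Suc n))) =
        (norm a * norm (a * b) ^ n) * norm (theta_term a b (int n))"
      using theta_term_plus1[OF ab, of "int n"]
      by (simp add: norm_mult norm_power add.commute mult_ac)
    also have "\<dots> \<le> 1 / 2 * norm (theta_term a b (int n))"
      by (intro mult_right_mono) (use N[OF \<open>n \<ge> N\<close>] in auto)
    finally show "norm (norm (theta_term a b (int (Suc n)))) \<le> 1 / 2 * norm (norm (theta_term a b (int n)))"
      by simp
  qed auto
qed

lemma summable_on_int: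
  fixes f :: "int \<Rightarrow> real"
  assumes "summable (\<lambda>n. norm (f (int n)))" "summable (\<lambda>n. norm (f (- int n)))"
  shows "f summable_on UNIV"
proof -
  have "f summable_on range int" "f summable_on range (\<lambda>n. - int n)"
    by (subst summable_on_reindex;
        use assms in \<open>force simp: o_def inj_on_def intro!: norm_summable_imp_summable_on\<close>)+
  \<comment> \<open>Zero lies in both ranges and is removed from the second to make the union
    disjoint.\<close>
  hence "f summable_on (range int \<union> (range (\<lambda>n. - int n) - {0}))"
    by (intro summable_on_Un_disjoint)
       (auto intro: summable_on_subset_banach[of f "range (\<lambda>n. - int n)"])
  also have "range int \<union> (range (\<lambda>n. - int n) - {0}) = UNIV"
    by (auto simp: image_iff) (metis int_cases2)+
  finally show ?thesis .
qed

lemma theta_term_abs_summable: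
  assumes "a \<noteq> 0" "b \<noteq> 0" "norm (a * b) < 1"
  shows "(\<lambda>j. norm (theta_term a b j)) summable_on UNIV"
  by (rule summable_on_int)
     (use theta_term_summable_nat[OF assms] theta_term_summable_nat[of b a] assms in
       \<open>auto simp: theta_term_uminus mult.commute\<close>)

text \<open>Lebesgue's dominated convergence theorem for the counting measure on \<open>A\<close>,
  with \<open>has_sum\<close> translated into an integral and back.\<close>

lemma has_sum_dominated_convergence:
  fixes f :: "nat \<Rightarrow> 'a \<Rightarrow> 'b :: {banach, second_countable_topology}"
  assumes sum: "\<And>n. (f n has_sum s n) A"
    and bound: "\<And>n x. x \<in> A \<Longrightarrow> norm (f n x) \<le> w x"
    and w: "w summable_on A"
    and lim: "\<And>x. x \<in> A \<Longrightarrow> (\<lambda>n. f n x) \<longlonglongrightarrow> g x"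
    and s: "s \<longlonglongrightarrow> S"
  shows "(g has_sum S) A"
proof -
  have w': "integrable (count_space A) w"
    using w bound[THEN order.trans[OF norm_ge_zero]] 
    by (metis abs_summable_equivalent abs_summable_on_def summable_on_iff_abs_summable_on_real)
  note dc = integrable_dominated_convergence integrable_dominated_convergence2
    integral_dominated_convergence
  have conv: "integrable (count_space A) g" "\<And>n. integrable (count_space A) (f n)"
    "(\<lambda>n. integral\<^sup>L (count_space A) (f n)) \<longlonglongrightarrow> integral\<^sup>L (count_space A) g"
    by ((rule dc[where w = w and s = f and f = g]; use w' lim bound in \<open>auto simp: AE_count_space\<close>)+)
  have eq: "(h has_sum integral\<^sup>L (count_space A) h) A" if "integrable (count_space A) h"
    for h :: "'a \<Rightarrow> 'b"
    using that infsetsum_infsum[of h A] abs_summable_equivalent[of h A]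
    by (auto simp: abs_summable_on_def infsetsum_def intro: has_sum_infsum abs_summable_summable)
  have "integral\<^sup>L (count_space A) (f n) = s n" for n
    using eq[OF conv(2)] sum has_sum_unique by blast
  with conv(3) s have "integral\<^sup>L (count_space A) g = S"
    by (metis (no_types, lifting) LIMSEQ_unique ext)
  with eq[OF conv(1)] show ?thesis by simp
qed

text \<open>Let \<open>N\<close> tend to infinity in the finite triple product. Each coefficient
  \<open>P (2 * N) * r (N + j) * r (N - j)\<close> tends to \<open>1 / (p; p)_\<infinity>\<close>
  and is bounded uniformly in \<open>N\<close> and \<open>j\<close>, so the absolutely summable
  theta terms dominate.\<close>

theorem ramanujan_theta_product:
  fixes a b :: complex
  assumes ab: "a \<noteq> 0" "b \<noteq> 0" and p: "norm (a * b) < 1"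
  shows "(theta_term a b has_sum
           (qpoch (- a) (a * b) * qpoch (- b) (a * b) * qpoch (a * b) (a * b))) UNIV"
proof -
  define p where "p = a * b"
  define P where "P = (\<lambda>n. \<Prod>i<n. 1 - p * p ^ i)"
  define r where "r = (\<lambda>k::int. if k < 0 then 0 else inverse (P (nat k)))"
  have np: "norm p < 1" using p by (simp add: p_def)
  let ?Q = "qpoch p p"
  have Q0: "?Q \<noteq> 0" using qpoch_nonzero[OF np np] .
  have P_lim: "P \<longlonglongrightarrow> ?Q"
    unfolding P_def by (rule qpoch_partial_products_LIMSEQ[OF np])
  have iP_lim: "(\<lambda>n. inverse (P n)) \<longlonglongrightarrow> inverse ?Q"
    by (intro tendsto_inverse P_lim Q0)
  obtain C where C: "C > 0" "\<And>n. norm (P n) \<le> C"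
    using P_lim by (metis Bseq_def convergentI convergent_imp_Bseq)
  obtain D where D: "D > 0" "\<And>n. norm (inverse (P n)) \<le> D"
    using iP_lim by (metis Bseq_def convergentI convergent_imp_Bseq)
  have r_bound: "norm (r k) \<le> D" for k
    using D by (auto simp: r_def)
  have r_lim: "(\<lambda>N. r (int N + j)) \<longlonglongrightarrow> inverse ?Q" for j
  proof -
    \<comment> \<open>For \<open>N \<ge> \<bar>j\<bar>\<close> the argument \<open>N + j\<close> is
      nonnegative, so the zero branch of \<open>r\<close> disappears in the limit.\<close>
    have "filterlim (\<lambda>N. nat (int N + j)) sequentially sequentially"
      by (rule filterlim_at_top_mono[OF filterlim_minus_const_nat_at_top[of "nat \<bar>j\<bar>"]]) 
         (auto intro!: always_eventually)
    from filterlim_compose[OF iP_lim this]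
    show ?thesis
    proof (rule Lim_transform_eventually)
      show "\<forall>\<^sub>F N in sequentially. inverse (P (nat (int N + j))) = r (int N + j)"
        using eventually_ge_at_top[of "nat \<bar>j\<bar>"]
        by eventually_elim (auto simp: r_def)
    qed
  qed
  have P2_lim: "(\<lambda>N. P (2 * N)) \<longlonglongrightarrow> ?Q"
    by (rule filterlim_compose[OF P_lim]) (auto intro!: filterlim_subseq strict_monoI)
  have "((\<lambda>j. ?Q * inverse ?Q * inverse ?Q * theta_term a b j) has_sum
           (qpoch (- a) p * qpoch (- b) p)) UNIV"
  proof (rule has_sum_dominated_convergence)
    show "((\<lambda>j. P (2 * N) * r (int N + j) * r (int N - j) * theta_term a b j) has_sum
           (\<Prod>k<N. (1 + a * p ^ k) * (1 + b * p ^ k))) UNIV" for N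
      unfolding P_def r_def by (rule finite_triple_product) (use ab np p_def in auto)
    show "norm (P (2 * N) * r (int N + j) * r (int N - j) * theta_term a b j)
            \<le> C * D * D * norm (theta_term a b j)" for N j
      unfolding norm_mult
      by (intro mult_mono r_bound C order.refl) (use C D in auto)
    show "(\<lambda>j. C * D * D * norm (theta_term a b j)) summable_on UNIV"
      by (intro summable_on_cmult_right theta_term_abs_summable ab p)
    show "(\<lambda>N. P (2 * N) * r (int N + j) * r (int N - j) * theta_term a b j)
       \<longlonglongrightarrow> ?Q * inverse ?Q * inverse ?Q * theta_term a b j" for j
      using r_lim[of "-j"] by (intro tendsto_mult P2_lim r_lim tendsto_const) simp
    show "(\<lambda>N. \<Prod>k<N. (1 + a * p ^ k) * (1 + b * p ^ k)) \<longlonglongrightarrow> qpoch (- a) p * qpoch (- b) p"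
      unfolding prod.distrib
      using tendsto_mult[OF qpoch_partial_products_LIMSEQ[OF np, of "-a"]
          qpoch_partial_products_LIMSEQ[OF np, of "-b"]] by simp
  qed
  \<comment> \<open>The limiting coefficient is \<open>1 / ?Q\<close>; multiplying by
    \<open>?Q\<close> clears it and supplies the third factor of the product.\<close>
  from has_sum_cmult_right[OF this, of ?Q]
  have "(theta_term a b has_sum (?Q * (qpoch (- a) p * qpoch (- b) p))) UNIV"
    using Q0 by (simp add: field_simps)
  thus ?thesis by (simp add: p_def mult_ac)
qed

section \<open>Dissection of q-products\<close>

text \<open>Group the exponents by their residue \<open>i\<close> modulo \<open>m\<close>. Partial
  products of length \<open>n * m\<close> regroup exactly, and these form a subsequence with the
  same limit.\<close>

lemma qpoch_split:
  assumes "norm p < 1" "m > 0"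
  shows "qpoch a p = (\<Prod>i<m. qpoch (a * p ^ i) (p ^ m))"
proof -
  have pm: "norm (p ^ m) < 1"
    using assms by (simp add: norm_power power_less_one_iff)
  have "(\<lambda>n. \<Prod>k<n * m. 1 - a * p ^ k) \<longlonglongrightarrow> qpoch a p"
    by (rule filterlim_compose[OF qpoch_partial_products_LIMSEQ[OF assms(1)]])
       (use assms in \<open>auto intro!: filterlim_subseq strict_monoI\<close>)
  also have "(\<lambda>n. \<Prod>k<n * m. 1 - a * p ^ k) = (\<lambda>n. \<Prod>i<m. \<Prod>k<n. 1 - a * p ^ i * (p ^ m) ^ k)"
  proof
    fix n
    have "(\<Prod>k<n * m. 1 - a * p ^ k) = (\<Prod>k<n. \<Prod>i<m. 1 - a * p ^ (i + k * m))"
      unfolding prod.nat_group[symmetric]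
      using prod.shift_bounds_nat_ivl[of "\<lambda>k. 1 - a * p ^ k" 0 "_ * m" m]
      by (simp add: atLeast0LessThan add.commute)
    also have "\<dots> = (\<Prod>i<m. \<Prod>k<n. 1 - a * p ^ (i + k * m))"
      by (rule prod.swap)
    finally show "(\<Prod>k<n * m. 1 - a * p ^ k) = (\<Prod>i<m. \<Prod>k<n. 1 - a * p ^ i * (p ^ m) ^ k)"
      by (simp add: power_add power_mult mult.commute[of _ m] mult.assoc)
  qed
  finally have "(\<lambda>n. \<Prod>i<m. \<Prod>k<n. 1 - a * p ^ i * (p ^ m) ^ k) \<longlonglongrightarrow> qpoch a p" .
  moreover have "(\<lambda>n. \<Prod>i<m. \<Prod>k<n. 1 - a * p ^ i * (p ^ m) ^ k) \<longlonglongrightarrow> (\<Prod>i<m. qpoch (a * p ^ i) (p ^ m))"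
    by (intro tendsto_prod qpoch_partial_products_LIMSEQ pm)
  ultimately show ?thesis by (rule LIMSEQ_unique)
qed

text \<open>Factorwise difference of squares:
  \<open>(1 - a * p ^ k) * (1 + a * p ^ k) = 1 - a ^ 2 * (p ^ 2) ^ k\<close>.\<close>

lemma qpoch_mult_uminus:
  assumes "norm p < 1"
  shows "qpoch a p * qpoch (- a) p = qpoch (a ^ 2) (p ^ 2)"
proof -
  have p2: "norm (p ^ 2) < 1"
    using assms by (simp add: norm_power power_less_one_iff)
  have "(\<lambda>n. (\<Prod>k<n. 1 - a * p ^ k) * (\<Prod>k<n. 1 - (- a) * p ^ k)) \<longlonglongrightarrow> qpoch a p * qpoch (- a) p"
    by (intro tendsto_mult qpoch_partial_products_LIMSEQ assms)
  also have "(\<lambda>n. (\<Prod>k<n. 1 - a * p ^ k) * (\<Prod>k<n. 1 - (- a) * p ^ k)) =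
      (\<lambda>n. \<Prod>k<n. 1 - a ^ 2 * (p ^ 2) ^ k)"
    by (auto simp: fun_eq_iff prod.distrib[symmetric] algebra_simps power2_eq_square power_mult_distrib intro!: prod.cong)
  finally show ?thesis
    using qpoch_partial_products_LIMSEQ[OF p2] LIMSEQ_unique by blast
qed

section \<open>Quadratic characters of 2 and 3\<close>

text \<open>Euler's criterion makes both sides congruent modulo \<open>p\<close>. Both lie in
  \<open>{- 1, 0, 1}\<close>, so they differ by at most 2, which is less than
  \<open>p\<close>.\<close>

lemma Legendre_mult:
  assumes "prime p" "2 < p"
  shows "Legendre (a * b) (int p) = Legendre a p * Legendre b p"
proof -
  have "[Legendre (a * b) p = (a * b) ^ ((p - 1) div 2)] (mod p)"
    by (rule euler_criterion[OF assms])
  also have "(a * b) ^ ((p - 1) div 2) = a ^ ((p - 1) div 2) * b ^ ((p - 1) div 2)"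
    by (rule power_mult_distrib)
  also have "[\<dots> = Legendre a p * Legendre b p] (mod p)"
    by (intro cong_mult cong_sym[OF euler_criterion[OF assms]])
  finally have 1: "int p dvd Legendre (a * b) p - Legendre a p * Legendre b p"
    by (simp add: cong_iff_dvd_diff)
  have "\<bar>Legendre (a * b) p - Legendre a p * Legendre b p\<bar> < int p"
    using assms(2) by (auto simp: Legendre_def)
  with 1 show ?thesis
    using dvd_imp_le_int[OF _ 1] by force
qed

lemma Legendre_square:
  assumes "prime p" "\<not> int p dvd a"
  shows "Legendre (a ^ 2) (int p) = 1"
proof -
  have "\<not> [a ^ 2 = 0] (mod int p)"
    using assms prime_dvd_power[of "int p" a 2] by (auto simp: cong_0_iff)
  moreover have "QuadRes p (a ^ 2)"
    unfolding QuadRes_def by (rule exI[of _ a]) simp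
  ultimately show ?thesis by (simp add: Legendre_def)
qed

text \<open>Gauss's lemma with multiplier 2: for \<open>p = 2 * k + 1\<close> the sign is determined
  by the number of \<open>x \<le> k\<close> with \<open>2 * x > k\<close>. This number is
  \<open>k - k div 2\<close>, whose parity depends on \<open>k mod 4\<close>, that is, on
  \<open>p mod 8\<close>.\<close>

theorem Legendre_two:
  assumes "prime p" "2 < p"
  shows "Legendre 2 (int p) = (if p mod 8 \<in> {1, 7} then 1 else - 1)"
proof -
  have "odd p" using assms prime_odd_nat by blast
  then obtain k where k: "p = 2 * k + 1" by (elim oddE)
  have "\<not> int p dvd 2"
    using assms(2) zdvd_imp_le[of "int p" 2] by auto
  then interpret GAUSS p 2
    by unfold_locales (use assms in \<open>auto simp: cong_0_iff\<close>)
  have half: "(int p - 1) div 2 = int k" and lt: "\<And>x. x \<le> int k \<Longrightarrow> x * 2 < int p"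
    using k by auto
  have A: "A = {0<..int k}"
    by (simp add: A_def half)
  \<comment> \<open>The doubles of the half system \<open>A\<close> stay below \<open>p\<close>, so
    reduction modulo \<open>p\<close> leaves them unchanged; \<open>E\<close> below keeps those
    exceeding \<open>k\<close>.\<close>
  have "C = (\<lambda>x. x * 2) ` A"
    unfolding C_def B_def image_image
    by (intro image_cong refl mod_pos_pos_trivial) (auto simp: A lt)
  hence "E = (\<lambda>x. x * 2) ` {int (k div 2)<..int k}"
    by (auto simp: E_def A half zdiv_int)
  hence "card E = k - k div 2"
    by (simp add: card_image inj_on_def)
  hence L: "Legendre 2 p = (- 1) ^ (k - k div 2)"
    using gauss_lemma by simp
  define t c where "t = k div 4" and "c = k mod 4"
  have kt: "k = 4 * t + c"
    unfolding t_def c_def by simp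
  have c: "c \<in> {0, 1, 2, 3}"
    unfolding c_def by simp presburger
  have "p mod 8 = 2 * c + 1"
    using c k kt by auto
  moreover have "k - k div 2 = 2 * t + (c - c div 2)"
    using c kt by auto
  ultimately show ?thesis
    unfolding L using c by (auto simp: power_add power_mult)
qed

lemma Legendre_mod_3:
  "Legendre (int n) 3 = (if n mod 3 = 0 then 0 else if n mod 3 = 1 then 1 else - 1)"
proof -
  have dvd: "[int n = 0] (mod 3) \<longleftrightarrow> n mod 3 = 0"
    unfolding cong_def by presburger
  have sq: "(y ^ 2) mod 3 = (if y mod 3 = 0 then 0 else 1)" for y :: int
  proof -
    have *: "(y ^ 2) mod 3 = ((y mod 3) ^ 2) mod 3" by (simp add: power_mod)
    have "y mod 3 = 0 \<or> y mod 3 = 1 \<or> y mod 3 = 2" by presburger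
    thus ?thesis unfolding * by auto
  qed
  \<comment> \<open>The residues 0 and 1 are their own square roots, which gives the witness
    \<open>n mod 3\<close>.\<close>
  have "n mod 3 \<noteq> 2 \<Longrightarrow> QuadRes 3 (int n)"
    unfolding QuadRes_def
    by (rule exI[of _ "int (n mod 3)"], unfold cong_def sq) presburger
  moreover have "QuadRes 3 (int n) \<Longrightarrow> n mod 3 \<noteq> 2"
    unfolding QuadRes_def cong_def sq by (auto split: if_splits; presburger)
  moreover have "n mod 3 = 0 \<or> n mod 3 = 1 \<or> n mod 3 = 2" by presburger
  ultimately show ?thesis
    unfolding Legendre_def dvd by auto
qed

lemma coprime_6_mod_12: "odd n \<and> \<not> 3 dvd n \<longleftrightarrow> n mod 12 \<in> {1, 5, 7, 11 :: nat}"
proof -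
  have parity: "odd n \<longleftrightarrow> odd (n mod 12)" and three: "3 dvd n \<longleftrightarrow> 3 dvd (n mod 12)"
    by (simp_all add: dvd_mod_iff)
  have "odd x \<and> \<not> 3 dvd x \<longleftrightarrow> x \<in> {1, 5, 7, 11}" if "x < 12" for x :: nat
  proof -
    have "x \<in> {0, 1, 2, 3, 4, 5, 6, 7, 8, 9, 10, 11}"
      using that by (simp, presburger)
    thus ?thesis by auto
  qed
  thus ?thesis unfolding parity three by simp
qed

text \<open>Quadratic reciprocity turns \<open>(3/p)\<close> into \<open>(p/3)\<close> times
  \<open>(- 1) ^ ((p - 1) div 2)\<close>. The first factor depends on \<open>p mod 3\<close>, the
  second on \<open>p mod 4\<close>.\<close>

theorem Legendre_three:
  assumes "prime p" "3 < p"
  shows "Legendre 3 (int p) = (if p mod 12 \<in> {1, 11} then 1 else - 1)"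
proof -
  have "odd p" using assms prime_odd_nat[of p] by auto
  moreover have "p mod 3 \<noteq> 0"
    using assms primes_dvd_imp_eq[of 3 p] by (auto simp: dvd_eq_mod_eq_0)
  ultimately have "p mod 12 \<in> {1, 5, 7, 11}"
    using coprime_6_mod_12[of p] by (simp add: dvd_eq_mod_eq_0)
  then obtain t c where t: "p = 12 * t + c" "c \<in> {1, 5, 7, 11}"
    by (metis mult_div_mod_eq)
  have "Legendre p 3 * Legendre 3 p = (- 1) ^ ((p - 1) div 2)"
    using Quadratic_Reciprocity[of p 3] assms by simp
  moreover have "p mod 12 = c mod 12" unfolding t(1) by presburger
  moreover have "p mod 3 = c mod 3" unfolding t(1) by presburger
  moreover have "(p - 1) div 2 = 6 * t + (c - 1) div 2" using t by auto
  ultimately show ?thesis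
    using t(2) unfolding Legendre_mod_3
    by (auto simp: power_add power_mult)
qed

section \<open>Kronecker symbols as periodic characters\<close>

lemma kronecker_1 [simp]: "kronecker a (Suc 0) = 1"
  by (simp add: kronecker_def)

lemma kronecker_prime_mult:
  assumes "prime p" "m > 0"
  shows "kronecker a (p * m) = kronecker_prime a p * kronecker a m"
  using assms by (simp add: kronecker_def prime_factorization_mult prime_factorization_prime)

lemma kronecker_prime_eq: "prime p \<Longrightarrow> kronecker a p = kronecker_prime a p"
  by (simp add: kronecker_def prime_factorization_prime)

text \<open>Both sides are multiplicative, so removing one prime factor at a time reduces the
  equality to primes.\<close>

lemma kronecker_eqI:
  assumes "n > 0" "g 1 = 1"
    and mult: "\<And>p m. prime p \<Longrightarrow> g (p * m) = g p * g m"
    and prime: "\<And>p. prime p \<Longrightarrow> kronecker_prime a p = g p"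
  shows "kronecker a n = g n"
  using assms(1)
proof (induction n rule: prime_divisors_induct)
  case (unit n)
  thus ?case using assms(2) by simp
next
  case (factor p n)
  thus ?case by (simp add: kronecker_prime_mult mult prime)
qed auto

text \<open>The even primitive Dirichlet character modulo 8, attached to the field
  \<open>Q(sqrt 2)\<close>. The table by residues makes its signs along arithmetic progressions
  directly readable.\<close>

definition chi8 :: "nat \<Rightarrow> int" where
  "chi8 n = (if even n then 0 else if n mod 8 \<in> {1, 7} then 1 else - 1)"

text \<open>The even primitive Dirichlet character modulo 12, attached to \<open>Q(sqrt 3)\<close>.
  Its square is the indicator of being coprime to 6.\<close>

definition chi12 :: "nat \<Rightarrow> int" where
  "chi12 n = (if n mod 12 \<in> {1, 11} then 1 else if n mod 12 \<in> {5, 7} then - 1 else 0)"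

lemma odd_mod_8: "odd n \<longleftrightarrow> n mod 8 \<in> {1, 3, 5, 7 :: nat}"
proof -
  have parity: "odd n \<longleftrightarrow> odd (n mod 8)"
    by (simp add: dvd_mod_iff)
  have "odd x \<longleftrightarrow> x \<in> {1, 3, 5, 7}" if "x < 8" for x :: nat
  proof -
    have "x \<in> {0, 1, 2, 3, 4, 5, 6, 7}"
      using that by (simp, presburger)
    thus ?thesis by auto
  qed
  thus ?thesis unfolding parity by simp
qed

lemma chi12_eq_0:
  assumes "even n \<or> 3 dvd n"
  shows "chi12 n = 0"
proof -
  have "n mod 12 \<notin> {1, 5, 7, 11}"
    using coprime_6_mod_12[of n] assms by blast
  thus ?thesis by (simp add: chi12_def)
qed

text \<open>If a factor is even, both sides vanish; otherwise both depend only on residues modulo 8,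
  and finitely many pairs of units remain.\<close>

lemma chi8_mult: "chi8 (m * n) = chi8 m * chi8 n"
proof (cases "odd m \<and> odd n")
  case True
  have units: "chi8 (x * y) = chi8 x * chi8 y" if "x \<in> {1, 3, 5, 7}" "y \<in> {1, 3, 5, 7}" for x y
    using that by (auto simp: chi8_def)
  have "chi8 (m * n) = chi8 ((m mod 8) * (n mod 8))"
    by (simp add: chi8_def mod_mult_eq dvd_mod_iff)
  also have "\<dots> = chi8 (m mod 8) * chi8 (n mod 8)"
    by (rule units) (use True in \<open>simp_all only: odd_mod_8\<close>)
  also have "\<dots> = chi8 m * chi8 n"
    by (simp add: chi8_def dvd_mod_iff)
  finally show ?thesis .
qed (auto simp: chi8_def)

text \<open>The arguments are all products of two unit representatives 1, 5, 7, 11 modulo 12, as the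
  finite check in \<open>chi12_mult\<close> requires.\<close>

lemma chi12_values:
  "chi12 1 = 1" "chi12 (Suc 0) = 1" "chi12 5 = - 1" "chi12 7 = - 1" "chi12 11 = 1"
  "chi12 25 = 1" "chi12 35 = 1" "chi12 49 = 1" "chi12 55 = - 1" "chi12 77 = - 1" "chi12 121 = 1"
  by (simp_all add: chi12_def)

lemma chi12_mult: "chi12 (m * n) = chi12 m * chi12 n"
proof (cases "(odd m \<and> \<not> 3 dvd m) \<and> (odd n \<and> \<not> 3 dvd n)")
  case True
  have units: "chi12 (x * y) = chi12 x * chi12 y" if "x \<in> {1, 5, 7, 11}" "y \<in> {1, 5, 7, 11}" for x y
    using that by (auto simp: chi12_values)
  have "chi12 (m * n) = chi12 ((m mod 12) * (n mod 12))"
    by (simp add: chi12_def mod_mult_eq dvd_mod_iff)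
  also have "\<dots> = chi12 (m mod 12) * chi12 (n mod 12)"
    by (rule units) (use True in \<open>simp_all only: coprime_6_mod_12\<close>)
  also have "\<dots> = chi12 m * chi12 n"
    by (simp add: chi12_def dvd_mod_iff)
  finally show ?thesis .
next
  case False
  hence "even (m * n) \<or> 3 dvd (m * n)" "even m \<or> 3 dvd m \<or> even n \<or> 3 dvd n"
    by auto
  thus ?thesis
    using chi12_eq_0[of m] chi12_eq_0[of n] chi12_eq_0[of "m * n"] by auto
qed

lemma kronecker_prime_2:
  assumes "prime p"
  shows "kronecker_prime 2 p = chi8 p"
proof (cases "p = 2")
  case False
  hence "2 < p" "odd p" using assms prime_ge_2_nat[of p] prime_odd_nat[of p] by auto
  thus ?thesis
    using Legendre_two[OF assms] by (simp add: kronecker_prime_def chi8_def)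
qed (simp add: kronecker_prime_def chi8_def)

lemma kronecker_prime_mult_left:
  assumes "prime p" "p = 2 \<Longrightarrow> even a \<or> even b"
  shows "kronecker_prime (a * b) p = kronecker_prime a p * kronecker_prime b p"
  using assms prime_ge_2_nat[of p]
  by (cases "p = 2") (auto simp: kronecker_prime_def Legendre_mult)

text \<open>For \<open>p > 3\<close> the square factor in \<open>12 = 2 ^ 2 * 3\<close> drops out
  and \<open>(3/p)\<close> remains; at 2 and 3 both sides are 0.\<close>

lemma kronecker_prime_12:
  assumes "prime p"
  shows "kronecker_prime 12 p = chi12 p"
proof (cases "p \<le> 3")
  case True
  hence "p = 2 \<or> p = 3" using prime_ge_2_nat[OF assms] by auto
  thus ?thesis
    by (auto simp: kronecker_prime_def chi12_def Legendre_def cong_def)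
next
  case False
  have p: "odd p" "p mod 3 \<noteq> 0"
    using assms prime_odd_nat[of p] primes_dvd_imp_eq[of 3 p] False by (auto simp: dvd_eq_mod_eq_0)
  have "\<not> int p dvd 2" using zdvd_imp_le[of "int p" 2] False by auto
  hence "Legendre 12 p = Legendre 3 p"
    using Legendre_mult[OF assms, of "2 ^ 2" 3] Legendre_square[OF assms, of 2] False by simp
  moreover have "p mod 12 \<in> {1, 11} \<or> p mod 12 \<in> {5, 7}"
    using p coprime_6_mod_12[of p] unfolding dvd_eq_mod_eq_0 by blast
  ultimately show ?thesis
    using Legendre_three[OF assms] False p by (auto simp: kronecker_prime_def chi12_def)
qed

lemma kronecker_2: "n > 0 \<Longrightarrow> kronecker 2 n = chi8 n"
  by (rule kronecker_eqI[where g = chi8]) (auto simp: chi8_mult kronecker_prime_2, simp add: chi8_def)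

lemma kronecker_12: "n > 0 \<Longrightarrow> kronecker 12 n = chi12 n"
  by (rule kronecker_eqI[where g = chi12]) (auto simp: chi12_mult kronecker_prime_12, simp add: chi12_def)

lemma kronecker_24: "n > 0 \<Longrightarrow> kronecker 24 n = chi12 n * chi8 n"
proof (rule kronecker_eqI[where g = "\<lambda>n. chi12 n * chi8 n"])
  fix p :: nat assume "prime p"
  thus "kronecker_prime 24 p = chi12 p * chi8 p"
    using kronecker_prime_mult_left[of p 12 2] by (simp add: kronecker_prime_2 kronecker_prime_12)
qed (auto simp: chi12_mult chi8_mult, simp add: chi12_def chi8_def)

text \<open>In \<open>18 = 3 ^ 2 * 2\<close> the square contributes no sign but forces the value 0
  at multiples of 3. The factor \<open>chi12 n ^ 2\<close> records this.\<close>

lemma kronecker_18: "n > 0 \<Longrightarrow> kronecker 18 n = chi12 n ^ 2 * chi8 n"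
proof (rule kronecker_eqI[where g = "\<lambda>n. chi12 n ^ 2 * chi8 n"])
  fix p :: nat assume p: "prime p"
  show "kronecker_prime 18 p = chi12 p ^ 2 * chi8 p"
  proof (cases "p = 2 \<or> p = 3")
    case True
    thus ?thesis by (auto simp: kronecker_prime_def chi12_def chi8_def Legendre_def cong_def)
  next
    case False
    hence p3: "3 < p" "odd p" "p mod 3 \<noteq> 0"
      using p prime_odd_nat[of p] primes_dvd_imp_eq[of 3 p] prime_ge_2_nat[of p] by (auto simp: dvd_eq_mod_eq_0)
    have "\<not> int p dvd 3" using zdvd_imp_le[of "int p" 3] p3 by auto
    hence "Legendre 18 p = Legendre 2 p"
      using Legendre_mult[OF p, of "3 ^ 2" 2] Legendre_square[OF p, of 3] p3 by simp
    moreover have "p mod 12 \<in> {1, 11} \<or> p mod 12 \<in> {5, 7}"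
      using p3 coprime_6_mod_12[of p] unfolding dvd_eq_mod_eq_0 by blast
    ultimately show ?thesis
      using kronecker_prime_2[OF p] p3 by (auto simp: kronecker_prime_def chi12_def)
  qed
qed (auto simp: chi12_mult chi8_mult power_mult_distrib, simp add: chi12_def chi8_def)

lemma kronecker_at_2: "kronecker (int n) 2 ^ 2 = (if even n then 0 else 1)"
  by (simp add: kronecker_prime_eq kronecker_prime_def)

lemma kronecker_at_3: "kronecker (int n) 3 ^ 2 = (if n mod 3 = 0 then 0 else 1)"
  by (simp add: kronecker_prime_eq kronecker_prime_def Legendre_mod_3)

lemma kronecker_at_6: "kronecker (int n) 6 ^ 2 = chi12 n ^ 2"
proof -
  have "kronecker (int n) 6 = kronecker (int n) 2 * kronecker (int n) 3"
    using kronecker_prime_mult[of 2 3 "int n"] by (simp add: kronecker_prime_eq)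
  hence "kronecker (int n) 6 ^ 2 = (if even n then 0 else 1) * (if n mod 3 = 0 then 0 else 1)"
    by (simp only: power_mult_distrib kronecker_at_2 kronecker_at_3)
  also have "\<dots> = chi12 n ^ 2"
  proof -
    have "even n \<or> n mod 3 = 0 \<longleftrightarrow> n mod 12 \<notin> {1, 5, 7, 11}"
      unfolding coprime_6_mod_12[symmetric] by (auto simp: dvd_eq_mod_eq_0)
    thus ?thesis by (auto simp: chi12_def)
  qed
  finally show ?thesis .
qed

section \<open>Theta series as products of the Euler function\<close>

text \<open>Euler's function, the product of \<open>1 - x ^ n\<close> over \<open>n \<ge> 1\<close>,
  not the totient. It is the eta function without the factor \<open>q^(1/24)\<close>.\<close>

definition euler_phi :: "complex \<Rightarrow> complex" where
  "euler_phi x = qpoch x x"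

lemma euler_phi_nonzero: "norm x < 1 \<Longrightarrow> euler_phi x \<noteq> 0"
  by (simp add: euler_phi_def qpoch_nonzero)

lemma norm_power_less_1:
  fixes x :: complex
  assumes "norm x < 1" "n > 0"
  shows "norm (x ^ n) < 1"
  using assms by (simp add: norm_power power_less_one_iff)

lemma qpoch_split_2:
  assumes "norm p < 1"
  shows "qpoch a p = qpoch a (p ^ 2) * qpoch (a * p) (p ^ 2)"
  using qpoch_split[OF assms, of 2 a] by (simp add: lessThan_Suc numeral_2_eq_2 mult_ac)

lemma qpoch_split_3:
  assumes "norm p < 1"
  shows "qpoch a p = qpoch a (p ^ 3) * qpoch (a * p) (p ^ 3) * qpoch (a * p ^ 2) (p ^ 3)"
  using qpoch_split[OF assms, of 3 a] by (simp add: lessThan_Suc numeral_2_eq_2 numeral_3_eq_3 mult_ac)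

text \<open>Separate the exponents of \<open>euler_phi x\<close> by parity: the even ones give
  \<open>euler_phi (x ^ 2)\<close>, the odd ones the left-hand side.\<close>

lemma qpoch_square_nome:
  assumes "norm x < 1"
  shows "qpoch x (x ^ 2) = euler_phi x / euler_phi (x ^ 2)"
  using qpoch_split_2[OF assms, of x] euler_phi_nonzero[OF norm_power_less_1[OF assms, of 2]]
  by (simp add: euler_phi_def power2_eq_square field_simps)

lemma qpoch_uminus_square_nome:
  assumes "norm x < 1"
  shows "qpoch (- x) (x ^ 2) = euler_phi (x ^ 2) ^ 2 / (euler_phi x * euler_phi (x ^ 4))"
proof -
  note x2 = norm_power_less_1[OF assms, of 2]
  have "qpoch x (x ^ 2) * qpoch (- x) (x ^ 2) = qpoch (x ^ 2) ((x ^ 2) ^ 2)"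
    by (rule qpoch_mult_uminus) (use x2 in simp)
  also have "\<dots> = euler_phi (x ^ 2) / euler_phi (x ^ 4)"
    using qpoch_square_nome[of "x ^ 2"] x2 by (simp flip: power_mult)
  finally show ?thesis
    using euler_phi_nonzero[OF assms] euler_phi_nonzero[OF x2]
      euler_phi_nonzero[OF norm_power_less_1[OF assms, of 4]]
    by (simp add: qpoch_square_nome[OF assms] field_simps power2_eq_square[of "euler_phi _"])
qed

text \<open>Only the factors with odd exponent change under \<open>x \<mapsto> - x\<close>. This
  transfers a product formula at \<open>x\<close> to one at \<open>- x\<close>, which yields three
  of the theta series below from their sign variants.\<close>

lemma euler_phi_uminus:
  assumes "norm x < 1"
  shows "euler_phi (- x) = euler_phi (x ^ 2) ^ 3 / (euler_phi x * euler_phi (x ^ 4))"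
proof -
  have "euler_phi (- x) = qpoch (- x) (x ^ 2) * euler_phi (x ^ 2)"
    using qpoch_square_nome[of "- x"] assms euler_phi_nonzero[OF norm_power_less_1[OF assms, of 2]]
    by simp
  thus ?thesis
    by (simp add: qpoch_uminus_square_nome[OF assms] power2_eq_square[of "euler_phi _"]
        power3_eq_cube[of "euler_phi _"])
qed

section \<open>Product formulas for \<open>f(a, b)\<close> at signed powers of
  \<open>x\<close>\<close>

lemma theta_1_1:
  assumes "norm x < 1" "x \<noteq> 0"
  shows "(theta_term x x has_sum
           (euler_phi (x ^ 2) ^ 5 / (euler_phi x ^ 2 * euler_phi (x ^ 4) ^ 2))) UNIV"
proof -
  have "(theta_term x x has_sum (qpoch (- x) (x ^ 2) * qpoch (- x) (x ^ 2) * euler_phi (x ^ 2))) UNIV"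
    using ramanujan_theta_product[of x x] assms norm_power_less_1[OF assms(1), of 2]
    by (simp add: euler_phi_def power2_eq_square)
  also have "qpoch (- x) (x ^ 2) * qpoch (- x) (x ^ 2) * euler_phi (x ^ 2) =
      euler_phi (x ^ 2) ^ 5 / (euler_phi x ^ 2 * euler_phi (x ^ 4) ^ 2)"
    unfolding qpoch_uminus_square_nome[OF assms(1)] by (simp add: power_numeral_reduce[of "euler_phi _"] mult_ac)
  finally show ?thesis .
qed

text \<open>The classes 1 and 3 modulo 4 make up the odd exponents, so two factors of the triple
  product merge into \<open>qpoch x (x ^ 2)\<close>.\<close>

lemma theta_neg_1_neg_3:
  assumes "norm x < 1" "x \<noteq> 0"
  shows "(theta_term (- x) (- (x ^ 3)) has_sum
           (euler_phi x * euler_phi (x ^ 4) / euler_phi (x ^ 2))) UNIV"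
proof -
  note x2 = norm_power_less_1[OF assms(1), of 2] and x4 = norm_power_less_1[OF assms(1), of 4]
  have ab: "- x * - (x ^ 3) = x ^ 4" by (simp add: power_numeral_reduce)
  have "(theta_term (- x) (- (x ^ 3)) has_sum
      (qpoch x (x ^ 4) * qpoch (x ^ 3) (x ^ 4) * euler_phi (x ^ 4))) UNIV"
    using ramanujan_theta_product[of "- x" "- (x ^ 3)", unfolded ab] assms x4
    by (simp add: euler_phi_def)
  also have "qpoch x (x ^ 4) * qpoch (x ^ 3) (x ^ 4) = qpoch x (x ^ 2)"
    using qpoch_split_2[of "x ^ 2" x] x2 by (simp add: power_numeral_reduce mult_ac)
  finally show ?thesis
    by (simp add: qpoch_square_nome[OF assms(1)])
qed

text \<open>Ramanujan's \<open>\<psi>(x) = f(x, x ^ 3)\<close>, obtained from the previous series at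
  \<open>- x\<close>.\<close>

lemma theta_1_3:
  assumes "norm x < 1" "x \<noteq> 0"
  shows "(theta_term x (x ^ 3) has_sum (euler_phi (x ^ 2) ^ 2 / euler_phi x)) UNIV"
  using theta_neg_1_neg_3[of "- x"] assms euler_phi_nonzero[OF norm_power_less_1[OF assms(1), of 2]]
    euler_phi_nonzero[OF norm_power_less_1[OF assms(1), of 4]]
  by (simp add: euler_phi_uminus power2_eq_square[of "euler_phi _"] power3_eq_cube[of "euler_phi _"])

lemma theta_1_5:
  assumes "norm x < 1" "x \<noteq> 0"
  shows "(theta_term x (x ^ 5) has_sum
           (euler_phi (x ^ 2) ^ 2 * euler_phi (x ^ 3) * euler_phi (x ^ 12) /
            (euler_phi x * euler_phi (x ^ 4) * euler_phi (x ^ 6)))) UNIV"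
proof -
  note xn = norm_power_less_1[OF assms(1)]
  have ab: "x * x ^ 5 = x ^ 6" by (simp add: power_numeral_reduce)
  have "(theta_term x (x ^ 5) has_sum
      (qpoch (- x) (x ^ 6) * qpoch (- (x ^ 5)) (x ^ 6) * euler_phi (x ^ 6))) UNIV"
    using ramanujan_theta_product[of x "x ^ 5", unfolded ab] assms xn[of 6]
    by (simp add: euler_phi_def)
  also have "qpoch (- x) (x ^ 6) * qpoch (- (x ^ 5)) (x ^ 6) * euler_phi (x ^ 6) =
      (euler_phi (x ^ 2) ^ 2 * euler_phi (x ^ 3) * euler_phi (x ^ 12) /
            (euler_phi x * euler_phi (x ^ 4) * euler_phi (x ^ 6)))"
  proof -
    \<comment> \<open>Odd exponents fall into the classes 1, 3, 5 modulo 6. The triple product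
      supplies classes 1 and 5, so class 3 is divided out.\<close>
    have "qpoch (- x) (x ^ 2) = qpoch (- x) (x ^ 6) * qpoch (- (x ^ 3)) (x ^ 6) * qpoch (- (x ^ 5)) (x ^ 6)"
      using qpoch_split_3[of "x ^ 2" "- x"] xn[of 2] by (simp add: power_numeral_reduce mult_ac)
    moreover have Q3: "qpoch (- (x ^ 3)) (x ^ 6) =
        euler_phi (x ^ 6) ^ 2 / (euler_phi (x ^ 3) * euler_phi (x ^ 12))"
      using qpoch_uminus_square_nome[OF xn[of 3]] by (simp flip: power_mult)
    moreover have nz: "euler_phi (x ^ 3) \<noteq> 0" "euler_phi (x ^ 6) \<noteq> 0" "euler_phi (x ^ 12) \<noteq> 0"
      by (simp_all add: euler_phi_nonzero xn)
    ultimately have "qpoch (- x) (x ^ 6) * qpoch (- (x ^ 5)) (x ^ 6) =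
        qpoch (- x) (x ^ 2) / qpoch (- (x ^ 3)) (x ^ 6)"
      by simp
    thus ?thesis
      unfolding Q3 qpoch_uminus_square_nome[OF assms(1)]
      using nz by (simp add: power2_eq_square[of "euler_phi _"] mult_ac)
  qed
  finally show ?thesis .
qed

text \<open>Euler's pentagonal number theorem: the three factors of the triple product are the
  residue classes modulo 3 of \<open>euler_phi x\<close>.\<close>

lemma theta_neg_1_neg_2:
  assumes "norm x < 1" "x \<noteq> 0"
  shows "(theta_term (- x) (- (x ^ 2)) has_sum euler_phi x) UNIV"
proof -
  have ab: "- x * - (x ^ 2) = x ^ 3" by (simp add: power_numeral_reduce)
  have "(theta_term (- x) (- (x ^ 2)) has_sum
      (qpoch x (x ^ 3) * qpoch (x ^ 2) (x ^ 3) * qpoch (x ^ 3) (x ^ 3))) UNIV"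
    using ramanujan_theta_product[of "- x" "- (x ^ 2)", unfolded ab] assms
      norm_power_less_1[OF assms(1), of 3] by simp
  also have "qpoch x (x ^ 3) * qpoch (x ^ 2) (x ^ 3) * qpoch (x ^ 3) (x ^ 3) = euler_phi x"
    using qpoch_split_3[OF assms(1), of x] by (simp add: euler_phi_def power_numeral_reduce)
  finally show ?thesis .
qed

lemma theta_1_neg_2:
  assumes "norm x < 1" "x \<noteq> 0"
  shows "(theta_term x (- (x ^ 2)) has_sum
           (euler_phi (x ^ 2) ^ 3 / (euler_phi x * euler_phi (x ^ 4)))) UNIV"
  using theta_neg_1_neg_2[of "- x"] assms by (simp add: euler_phi_uminus)

lemma theta_1_2:
  assumes "norm x < 1" "x \<noteq> 0"
  shows "(theta_term x (x ^ 2) has_sum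
           (euler_phi (x ^ 2) * euler_phi (x ^ 3) ^ 2 / (euler_phi x * euler_phi (x ^ 6)))) UNIV"
proof -
  note xn = norm_power_less_1[OF assms(1)]
  have ab: "x * x ^ 2 = x ^ 3" by (simp add: power_numeral_reduce)
  have "(theta_term x (x ^ 2) has_sum
      (qpoch (- x) (x ^ 3) * qpoch (- (x ^ 2)) (x ^ 3) * euler_phi (x ^ 3))) UNIV"
    using ramanujan_theta_product[of x "x ^ 2", unfolded ab] assms xn[of 3]
    by (simp add: euler_phi_def)
  also have "qpoch (- x) (x ^ 3) * qpoch (- (x ^ 2)) (x ^ 3) * euler_phi (x ^ 3) =
      euler_phi (x ^ 2) * euler_phi (x ^ 3) ^ 2 / (euler_phi x * euler_phi (x ^ 6))"
  proof -
    \<comment> \<open>The triple product supplies the classes 1 and 2 modulo 3 of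
      \<open>qpoch (- x) x\<close>; the class of multiples of 3 is the same product at
      \<open>x ^ 3\<close>.\<close>
    have split: "qpoch (- x) x = qpoch (- x) (x ^ 3) * qpoch (- (x ^ 2)) (x ^ 3) * qpoch (- (x ^ 3)) (x ^ 3)"
      using qpoch_split_3[OF assms(1), of "- x"] by (simp add: power_numeral_reduce)
    have "euler_phi y * qpoch (- y) y = euler_phi (y ^ 2)" if "norm y < 1" for y
      using qpoch_mult_uminus[OF that, of y] by (simp add: euler_phi_def)
    from this[OF assms(1)] this[OF xn[of 3]]
    have eqs: "euler_phi x * qpoch (- x) x = euler_phi (x ^ 2)"
      "euler_phi (x ^ 3) * qpoch (- (x ^ 3)) (x ^ 3) = euler_phi (x ^ 6)"
      by (simp_all flip: power_mult)
    have "euler_phi x * (qpoch (- x) (x ^ 3) * qpoch (- (x ^ 2)) (x ^ 3)) * euler_phi (x ^ 6) =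
        euler_phi (x ^ 2) * euler_phi (x ^ 3)"
      unfolding eqs[symmetric] split by (simp only: mult_ac)
    thus ?thesis
      using euler_phi_nonzero[OF assms(1)] euler_phi_nonzero[OF xn[of 6]]
      by (simp add: field_simps power2_eq_square[of "euler_phi _"])
  qed
  finally show ?thesis .
qed

text \<open>The preceding formula at \<open>- x\<close>; \<open>euler_phi_uminus\<close> at
  \<open>x\<close> and at \<open>x ^ 3\<close> removes the negative arguments.\<close>

lemma theta_neg_1_2:
  assumes "norm x < 1" "x \<noteq> 0"
  shows "(theta_term (- x) (x ^ 2) has_sum
           (euler_phi x * euler_phi (x ^ 4) * euler_phi (x ^ 6) ^ 5 /
            (euler_phi (x ^ 2) ^ 2 * euler_phi (x ^ 3) ^ 2 * euler_phi (x ^ 12) ^ 2))) UNIV"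
proof -
  note xn = norm_power_less_1[OF assms(1)]
  have "(theta_term (- x) (x ^ 2) has_sum
      (euler_phi (x ^ 2) * euler_phi (- (x ^ 3)) ^ 2 / (euler_phi (- x) * euler_phi (x ^ 6)))) UNIV"
    using theta_1_2[of "- x"] assms by simp
  also have cube: "euler_phi (- (x ^ 3)) =
      euler_phi (x ^ 6) ^ 3 / (euler_phi (x ^ 3) * euler_phi (x ^ 12))"
    using euler_phi_uminus[OF xn[of 3]] by (simp flip: power_mult)
  also have "euler_phi (x ^ 2) *
      (euler_phi (x ^ 6) ^ 3 / (euler_phi (x ^ 3) * euler_phi (x ^ 12))) ^ 2 /
      (euler_phi (- x) * euler_phi (x ^ 6)) =
      euler_phi x * euler_phi (x ^ 4) * euler_phi (x ^ 6) ^ 5 /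
      (euler_phi (x ^ 2) ^ 2 * euler_phi (x ^ 3) ^ 2 * euler_phi (x ^ 12) ^ 2)"
    unfolding euler_phi_uminus[OF assms(1)]
    using euler_phi_nonzero[OF assms(1)] euler_phi_nonzero[OF xn[of 2]] euler_phi_nonzero[OF xn[of 3]]
      euler_phi_nonzero[OF xn[of 4]] euler_phi_nonzero[OF xn[of 6]] euler_phi_nonzero[OF xn[of 12]]
    by (simp add: field_simps power_numeral_reduce[of "euler_phi _"])
  finally show ?thesis .
qed

section \<open>Square exponents and periodic signs\<close>

lemma choose_2_int:
  fixes n :: int
  shows "2 * (n * (n + 1) div 2) = n * n + n" "2 * (n * (n - 1) div 2) = n * n - n"
  by (simp_all add: algebra_simps)

lemma theta_term_mult:
  "theta_term (s * a) (t * b) n = theta_term s t n * theta_term a b n"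
  by (simp add: theta_term_def power_int_mult_distrib)

lemma theta_term_power:
  assumes "q \<noteq> 0"
  shows "theta_term (q ^ k) (q ^ l) n =
           q powi (int k * (n * (n + 1) div 2) + int l * (n * (n - 1) div 2))"
  using assms by (simp add: theta_term_def power_int_add power_int_mult)

text \<open>The exponents of \<open>q * theta_term (q ^ k) (q ^ l)\<close> are the squares \<open>(c * n - 1)\<^sup>2\<close>.\<close>

lemma theta_term_complete_square:
  assumes "q \<noteq> 0" "k + l = 2 * c ^ 2" "l = k + 4 * c"
  shows "q * theta_term (s * q ^ k) (t * q ^ l) n =
           theta_term s t n * q ^ (nat \<bar>int c * n - 1\<bar> ^ 2)"
proof -
  define A B where "A = n * (n + 1) div 2" and "B = n * (n - 1) div 2"
  have "2 * (1 + (int k * A + int l * B)) = 2 * (int c * n - 1) ^ 2"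
  proof -
    have "2 * (1 + (int k * A + int l * B)) = 2 + (int k * (2 * A) + int l * (2 * B))"
      by (simp add: algebra_simps)
    also have "\<dots> = 2 + int (k + l) * n\<^sup>2 - (int l - int k) * n"
      unfolding A_def B_def choose_2_int by (simp add: algebra_simps power2_eq_square)
    also have "int l - int k = 4 * int c" using assms(3) by simp
    also have "int (k + l) = 2 * int c ^ 2" using assms(2) by simp
    also have "2 + 2 * (int c)\<^sup>2 * n\<^sup>2 - 4 * int c * n = 2 * (int c * n - 1) ^ 2"
      by (simp add: power2_eq_square algebra_simps)
    finally show ?thesis .
  qed
  hence "1 + (int k * A + int l * B) = int (nat \<bar>int c * n - 1\<bar> ^ 2)"
    by simp
  hence "q powi (1 + (int k * A + int l * B)) = q ^ (nat \<bar>int c * n - 1\<bar> ^ 2)"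
    by (simp only: power_int_of_nat)
  thus ?thesis
    using assms(1) by (simp add: theta_term_mult theta_term_power power_int_add A_def B_def)
qed

lemma theta_term_neg_neg: "theta_term (- 1) (- 1) n = (if even n then 1 else - 1)"
proof -
  have "theta_term (- 1) (- 1) n = (- 1) powi (n * (n + 1) div 2 + n * (n - 1) div 2)"
    by (simp add: theta_term_def power_int_add)
  also have "n * (n + 1) div 2 + n * (n - 1) div 2 = n * n"
    using choose_2_int[of n] by linarith
  finally show ?thesis by (simp add: power_int_minus_one_mult_self power_int_minus_left)
qed

text \<open>Replacing \<open>n\<close> by \<open>n + 4\<close> changes either triangular number by
  an even amount, so only \<open>n mod 4\<close> matters.\<close>

lemma even_choose_2_int:
  fixes n :: int
  shows "even (n * (n + 1) div 2) \<longleftrightarrow> n mod 4 \<in> {0, 3}"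
    and "even (n * (n - 1) div 2) \<longleftrightarrow> n mod 4 \<in> {0, 1}"
proof -
  define t r where "t = n div 4" and "r = n mod 4"
  have n: "n = 4 * t + r" by (simp add: t_def r_def)
  have r: "r \<in> {0, 1, 2, 3}" unfolding r_def by (simp, presburger)
  have "2 * (n * (n + 1) div 2) = 2 * (2 * (4 * t * t + 2 * r * t + t) + r * (r + 1) div 2)"
    unfolding choose_2_int distrib_left using choose_2_int[of r]
    by (simp add: n algebra_simps)
  hence "n * (n + 1) div 2 = 2 * (4 * t * t + 2 * r * t + t) + r * (r + 1) div 2" by simp
  thus "even (n * (n + 1) div 2) \<longleftrightarrow> n mod 4 \<in> {0, 3}"
    using r by (auto simp flip: r_def)
  have "2 * (n * (n - 1) div 2) = 2 * (2 * (4 * t * t + 2 * r * t - t) + r * (r - 1) div 2)"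
    unfolding choose_2_int distrib_left using choose_2_int[of r]
    by (simp add: n algebra_simps)
  hence "n * (n - 1) div 2 = 2 * (4 * t * t + 2 * r * t - t) + r * (r - 1) div 2" by simp
  thus "even (n * (n - 1) div 2) \<longleftrightarrow> n mod 4 \<in> {0, 1}"
    using r by (auto simp flip: r_def)
qed

lemma theta_term_pos_neg: "theta_term 1 (- 1) n = (if n mod 4 \<in> {0, 1} then 1 else - 1)"
  using even_choose_2_int(2)[of n] by (simp add: theta_term_def power_int_minus_left)

lemma theta_term_neg_pos: "theta_term (- 1) 1 n = (if n mod 4 \<in> {0, 3} then 1 else - 1)"
  using even_choose_2_int(1)[of n] by (simp add: theta_term_def power_int_minus_left)

lemma theta_term_one: "theta_term 1 1 n = 1"
  by (simp add: theta_term_def)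

lemma chi8_nat_abs:
  "chi8 (nat \<bar>z\<bar>) = (if even z then 0 else if z mod 8 \<in> {1, 7} then 1 else - 1)"
proof -
  have nat: "chi8 m = (if even (int m) then 0 else if int m mod 8 \<in> {1, 7} then 1 else - 1)" for m
  proof -
    have "int m mod 8 = int (m mod 8)" by (simp add: zmod_int)
    moreover have "int x \<in> {1, 7} \<longleftrightarrow> x \<in> {1, 7}" for x by auto
    ultimately show ?thesis by (simp only: chi8_def even_of_nat_iff)
  qed
  show ?thesis
    unfolding nat by (auto simp: abs_if zmod_zminus1_eq_if)
qed

lemma chi12_nat_abs:
  "chi12 (nat \<bar>z\<bar>) = (if z mod 12 \<in> {1, 11} then 1 else if z mod 12 \<in> {5, 7} then - 1 else 0)"
proof -
  have nat: "chi12 m = (if int m mod 12 \<in> {1, 11} then 1 else if int m mod 12 \<in> {5, 7} then - 1 else 0)" for m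
  proof -
    have "int m mod 12 = int (m mod 12)" by (simp add: zmod_int)
    moreover have "int x \<in> {1, 11} \<longleftrightarrow> x \<in> {1, 11}" "int x \<in> {5, 7} \<longleftrightarrow> x \<in> {5, 7}" for x
      by auto
    ultimately show ?thesis by (simp only: chi12_def)
  qed
  have "(if r = 0 then 0 else 12 - r) \<in> {1, 11} \<longleftrightarrow> r \<in> {1, 11}"
    "(if r = 0 then 0 else 12 - r) \<in> {5, 7} \<longleftrightarrow> r \<in> {5, 7}" for r :: int
    by auto
  from this[of "z mod 12"] have "\<bar>z\<bar> mod 12 \<in> {1, 11} \<longleftrightarrow> z mod 12 \<in> {1, 11}"
    "\<bar>z\<bar> mod 12 \<in> {5, 7} \<longleftrightarrow> z mod 12 \<in> {5, 7}"
    by (cases "z < 0"; simp only: abs_if if_True if_False zmod_zminus1_eq_if)+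
  moreover have "int (nat \<bar>z\<bar>) = \<bar>z\<bar>" by simp
  ultimately show ?thesis
    unfolding nat by (simp only:)
qed

lemma chi8_4_minus_1: "chi8 (nat \<bar>4 * n - 1\<bar>) = (if even n then 1 else - 1)"
proof (cases "even n")
  case True
  then obtain t where n: "n = 2 * t" by (elim evenE)
  have "(4 * n - 1) mod 8 = 7" unfolding n by presburger
  thus ?thesis unfolding chi8_nat_abs using True by simp
next
  case False
  then obtain t where n: "n = 2 * t + 1" by (elim oddE)
  have "(4 * n - 1) mod 8 = 3" unfolding n by presburger
  thus ?thesis unfolding chi8_nat_abs using False by simp
qed

lemma chi12_6_minus_1: "chi12 (nat \<bar>6 * n - 1\<bar>) = (if even n then 1 else - 1)"
proof (cases "even n")
  case True
  then obtain t where n: "n = 2 * t" by (elim evenE)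
  have "(6 * n - 1) mod 12 = 11" unfolding n by presburger
  thus ?thesis unfolding chi12_nat_abs using True by simp
next
  case False
  then obtain t where n: "n = 2 * t + 1" by (elim oddE)
  have "(6 * n - 1) mod 12 = 5" unfolding n by presburger
  thus ?thesis unfolding chi12_nat_abs using False by simp
qed

text \<open>As \<open>n\<close> runs through 0, 1, 2, 3 modulo 4, \<open>6 * n - 1\<close> runs
  through 7, 5, 3, 1 modulo 8.\<close>

lemma chi8_6_minus_1: "chi8 (nat \<bar>6 * n - 1\<bar>) = (if n mod 4 \<in> {0, 3} then 1 else - 1)"
proof -
  define t r where "t = n div 4" and "r = n mod 4"
  have n: "n = 4 * t + r" by (simp add: t_def r_def)
  have r: "r \<in> {0, 1, 2, 3}" unfolding r_def by (simp, presburger)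
  have "(6 * n - 1) mod 8 = (6 * r - 1) mod 8" unfolding n by presburger
  moreover have "odd (6 * n - 1)" by simp
  ultimately show ?thesis
    unfolding chi8_nat_abs r_def[symmetric] using r by auto
qed

section \<open>From two-sided theta series to sums over positive integers\<close>

text \<open>The map \<open>n \<mapsto> \<bar>c * n - 1\<bar>\<close> is a bijection from the
  integers onto the positive integers congruent to 1 or -1 modulo \<open>c\<close>. The bound
  \<open>c > 2\<close> keeps these classes apart.\<close>

lemma has_sum_over_square_roots:
  fixes f :: "nat \<Rightarrow> 'a :: {comm_monoid_add, t2_space}" and c :: nat
  assumes c: "c > 2"
    and sum: "((\<lambda>n::int. f (nat \<bar>int c * n - 1\<bar>)) has_sum S) UNIV"
    and zero: "\<And>m. m mod c \<noteq> 1 \<Longrightarrow> m mod c \<noteq> c - 1 \<Longrightarrow> f m = 0"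
  shows "(f has_sum S) {1..}"
proof -
  let ?h = "\<lambda>n::int. nat \<bar>int c * n - 1\<bar>"
  have "inj ?h"
  proof (rule injI)
    fix x y assume "?h x = ?h y"
    hence "int c * x - 1 = int c * y - 1 \<or> int c * x - 1 = - (int c * y - 1)"
      by (simp add: nat_eq_iff abs_eq_iff)
    moreover have "int c * x - 1 \<noteq> - (int c * y - 1)"
    proof
      assume "int c * x - 1 = - (int c * y - 1)"
      hence "int c * (x + y) = 2" by (simp add: algebra_simps)
      hence "int c dvd 2" by (metis dvd_triv_left)
      thus False using c zdvd_imp_le[of "int c" 2] by auto
    qed
    ultimately show "x = y" using c by simp
  qed
  hence "(f has_sum S) (range ?h)"
    using sum by (subst has_sum_reindex) (auto simp: o_def)
  also have "?this \<longleftrightarrow> (f has_sum S) {1..}"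
  proof (rule has_sum_cong_neutral)
    fix m assume m: "m \<in> {1..} - range ?h"
    show "f m = 0"
    proof (rule zero; rule notI)
      define d where "d = m div c"
      assume "m mod c = 1"
      hence "int m = int c * int d + 1"
        unfolding d_def by (metis mult_div_mod_eq of_nat_1 of_nat_add of_nat_mult)
      hence "m = ?h (- int d)" by simp
      thus False using m by blast
    next
      define d where "d = m div c"
      assume "m mod c = c - 1"
      hence "int m = int c * int d + int (c - 1)"
        unfolding d_def by (metis mult_div_mod_eq of_nat_add of_nat_mult)
      hence "int m = int c * (int d + 1) - 1"
        using c by (simp add: algebra_simps of_nat_diff)
      hence "m = ?h (int d + 1)" by simp
      thus False using m by blast
    qed
  next
    \<comment> \<open>Only \<open>m = 0\<close> could lie outside \<open>{1..}\<close>, and that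
      would require \<open>c * n = 1\<close>.\<close>
    fix m assume "m \<in> range ?h - {1..}"
    then obtain n where "int c * n = 1" by (auto simp: not_le)
    hence "int c dvd 1" by (metis dvd_triv_left)
    thus "f m = 0" using c by simp
  qed auto
  finally show ?thesis .
qed

text \<open>The conditions mean \<open>k = c ^ 2 - 2 * c\<close> and
  \<open>l = c ^ 2 + 2 * c\<close>: the pairs (3, 15), (8, 24), (24, 48) for \<open>c\<close> equal
  to 3, 4, 6. The coefficient \<open>g\<close> extends the sign pattern of \<open>s\<close>,
  \<open>t\<close> by zero.\<close>

lemma has_sum_theta_squares:
  assumes q: "q \<noteq> 0" and c: "c > 2" "k + l = 2 * c ^ 2" "l = k + 4 * c"
    and theta: "(theta_term (s * q ^ k) (t * q ^ l) has_sum S) UNIV"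
    and g: "\<And>n. of_int (g (nat \<bar>int c * n - 1\<bar>)) = theta_term s t n"
    and zero: "\<And>m. m mod c \<noteq> 1 \<Longrightarrow> m mod c \<noteq> c - 1 \<Longrightarrow> g m = 0"
  shows "((\<lambda>m. of_int (g m) * q ^ (m ^ 2)) has_sum (q * S)) {1..}"
proof (rule has_sum_over_square_roots[OF c(1)])
  show "((\<lambda>n. of_int (g (nat \<bar>int c * n - 1\<bar>)) * q ^ (nat \<bar>int c * n - 1\<bar>)\<^sup>2) has_sum q * S) UNIV"
    unfolding g theta_term_complete_square[OF q c(2,3), symmetric]
    by (rule has_sum_cmult_right[OF theta])
qed (simp add: zero)

text \<open>Fixing one value \<open>e\<close> of \<open>q^(1/24)\<close> turns all fractional
  prefactors into natural powers of \<open>e\<close>, so no choice of branch arises.\<close>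

lemma dedekind_eta_euler_phi:
  assumes "q = exp (2 * of_real pi * \<i> * \<tau>)" "e = exp (2 * of_real pi * \<i> * \<tau> / 24)"
  shows "dedekind_eta \<tau> = e * euler_phi q"
    "dedekind_eta (numeral k * \<tau>) = e ^ numeral k * euler_phi (q ^ numeral k)"
proof -
  show "dedekind_eta \<tau> = e * euler_phi q"
    by (simp add: dedekind_eta_def euler_phi_def qpoch_def assms)
  have eq: "c * (K * \<tau>) / 24 = K * (c * \<tau> / 24)" "c * (K * \<tau>) = K * (c * \<tau>)" for c K
    by simp_all
  have "exp (2 * of_real pi * \<i> * (numeral k * \<tau>) / 24) = e ^ numeral k"
    unfolding assms exp_of_nat_mult[symmetric] eq(1) of_nat_numeral ..
  moreover have "exp (2 * of_real pi * \<i> * (numeral k * \<tau>)) = q ^ numeral k"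
    unfolding assms exp_of_nat_mult[symmetric] eq(2) of_nat_numeral ..
  ultimately show "dedekind_eta (numeral k * \<tau>) = e ^ numeral k * euler_phi (q ^ numeral k)"
    by (simp add: dedekind_eta_def euler_phi_def qpoch_def)
qed

lemma even_if_mod_4: "(m::nat) mod 4 \<noteq> 1 \<Longrightarrow> m mod 4 \<noteq> 4 - 1 \<Longrightarrow> even m"
  by (simp, presburger)

lemma eq_0_if_mod_3: "(m::nat) mod 3 \<noteq> 1 \<Longrightarrow> m mod 3 \<noteq> 3 - 1 \<Longrightarrow> m mod 3 = 0"
  by presburger

lemma chi12_eq_0_mod_6:
  assumes "m mod 6 \<noteq> 1" "m mod 6 \<noteq> 6 - 1"
  shows "chi12 m = 0"
proof (rule chi12_eq_0)
  show "even m \<or> 3 dvd m" using assms by (simp, presburger)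
qed

lemma nat_abs_3_minus_1_mod_3: "nat \<bar>3 * n - 1\<bar> mod 3 \<noteq> 0"
proof
  assume "nat \<bar>3 * n - 1\<bar> mod 3 = 0"
  hence "int 3 dvd int (nat \<bar>3 * n - 1\<bar>)"
    unfolding int_dvd_int_iff by (rule mod_0_imp_dvd)
  hence "3 dvd 3 * n - 1" by simp
  thus False by presburger
qed

lemma chi12_chi8_6_minus_1:
  "chi12 (nat \<bar>6 * n - 1\<bar>) * chi8 (nat \<bar>6 * n - 1\<bar>) = (if n mod 4 \<in> {0, 1} then 1 else - 1)"
proof -
  have "even n \<longleftrightarrow> even (n mod 4)" by (simp add: dvd_mod_iff)
  moreover have "n mod 4 \<in> {0, 1, 2, 3}" by (simp, presburger)
  ultimately show ?thesis
    unfolding chi12_6_minus_1 chi8_6_minus_1 by auto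
qed

text \<open>Here \<open>has_sum\<close> asserts unconditional convergence together with the value.
  The index set \<open>{1..}\<close> excludes \<open>n = 0\<close>, where \<open>kronecker\<close>
  has a junk value.\<close>

theorem theorem2p1:
  fixes \<tau> q :: complex
  assumes "Im \<tau> > 0"
    and "q = exp (2 * of_real pi * \<i> * \<tau>)"
  shows
    "((\<lambda>n::int. q powi (n ^ 2)) has_sum
       (dedekind_eta (2 * \<tau>) ^ 5 / (dedekind_eta \<tau> ^ 2 * dedekind_eta (4 * \<tau>) ^ 2))) UNIV
     \<and>
     ((\<lambda>n::nat. of_int (kronecker 2 n) * q ^ (n ^ 2)) has_sum
       (dedekind_eta (8 * \<tau>) * dedekind_eta (32 * \<tau>) / dedekind_eta (16 * \<tau>))) {1..}
     \<and>
     ((\<lambda>n::nat. of_int (kronecker (int n) 2) ^ 2 * q ^ (n ^ 2)) has_sum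
       (dedekind_eta (16 * \<tau>) ^ 2 / dedekind_eta (8 * \<tau>))) {1..}
     \<and>
     ((\<lambda>n::nat. of_int (kronecker (int n) 3) ^ 2 * q ^ (n ^ 2)) has_sum
       (dedekind_eta (6 * \<tau>) ^ 2 * dedekind_eta (9 * \<tau>) * dedekind_eta (36 * \<tau>) /
        (dedekind_eta (3 * \<tau>) * dedekind_eta (12 * \<tau>) * dedekind_eta (18 * \<tau>)))) {1..}
     \<and>
     ((\<lambda>n::nat. of_int (kronecker 12 n) * q ^ (n ^ 2)) has_sum
       dedekind_eta (24 * \<tau>)) {1..}
     \<and>
     ((\<lambda>n::nat. of_int (kronecker 24 n) * q ^ (n ^ 2)) has_sum
       (dedekind_eta (48 * \<tau>) ^ 3 / (dedekind_eta (24 * \<tau>) * dedekind_eta (96 * \<tau>)))) {1..}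
     \<and>
     ((\<lambda>n::nat. of_int (kronecker (int n) 6) ^ 2 * q ^ (n ^ 2)) has_sum
       (dedekind_eta (48 * \<tau>) * dedekind_eta (72 * \<tau>) ^ 2 /
        (dedekind_eta (24 * \<tau>) * dedekind_eta (144 * \<tau>)))) {1..}
     \<and>
     ((\<lambda>n::nat. of_int (kronecker 18 n) * q ^ (n ^ 2)) has_sum
       (dedekind_eta (24 * \<tau>) * dedekind_eta (96 * \<tau>) * dedekind_eta (144 * \<tau>) ^ 5 /
        (dedekind_eta (48 * \<tau>) ^ 2 * dedekind_eta (72 * \<tau>) ^ 2 * dedekind_eta (288 * \<tau>) ^ 2))) {1..}"
proof -
  define e where "e = exp (2 * of_real pi * \<i> * \<tau> / 24)"
  have e: "e \<noteq> 0" by (simp add: e_def)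
  have qe: "q = e ^ 24"
    unfolding assms(2) e_def exp_of_nat_mult[symmetric] by (simp add: mult_ac)
  have q: "q \<noteq> 0" using e qe by simp
  have q1: "norm q < 1"
    using assms(1) by (simp add: assms(2))
  note qn = norm_power_less_1[OF q1]
  note eta = dedekind_eta_euler_phi[OF assms(2) e_def]

  have 1: "((\<lambda>n::int. q powi (n ^ 2)) has_sum
       (dedekind_eta (2 * \<tau>) ^ 5 / (dedekind_eta \<tau> ^ 2 * dedekind_eta (4 * \<tau>) ^ 2))) UNIV"
  proof -
    have term_eq: "theta_term q q = (\<lambda>n. q powi (n ^ 2))"
    proof
      fix n :: int
      have "n * (n + 1) div 2 + n * (n - 1) div 2 = n ^ 2"
        using choose_2_int[of n] unfolding power2_eq_square by linarith
      thus "theta_term q q n = q powi (n ^ 2)"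
        using theta_term_power[OF q, of 1 1 n] by simp
    qed
    \<comment> \<open>The prefactors cancel: \<open>2 * 5 - 2 * 1 - 2 * 4 = 0\<close>.\<close>
    have "1 = (e ^ 2) ^ 5 / (e ^ 2 * (e ^ 4) ^ 2)"
      using e by (simp flip: power_mult power_add)
    hence "1 * (euler_phi (q ^ 2) ^ 5 / (euler_phi q ^ 2 * euler_phi (q ^ 4) ^ 2)) =
        (e ^ 2) ^ 5 / (e ^ 2 * (e ^ 4) ^ 2) *
        (euler_phi (q ^ 2) ^ 5 / (euler_phi q ^ 2 * euler_phi (q ^ 4) ^ 2))"
      by (rule arg_cong)
    also have "\<dots> = dedekind_eta (2 * \<tau>) ^ 5 / (dedekind_eta \<tau> ^ 2 * dedekind_eta (4 * \<tau>) ^ 2)"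
      unfolding eta power_mult_distrib times_divide_times_eq by (simp only: mult_ac)
    finally show ?thesis
      using theta_1_1[OF q1 q] unfolding term_eq by (simp only: mult_1_left)
  qed

  have 2: "((\<lambda>n::nat. of_int (kronecker 2 n) * q ^ (n ^ 2)) has_sum
       (dedekind_eta (8 * \<tau>) * dedekind_eta (32 * \<tau>) / dedekind_eta (16 * \<tau>))) {1..}"
  proof -
    let ?S = "euler_phi (q ^ 8) * euler_phi (q ^ 32) / euler_phi (q ^ 16)"
    have "((\<lambda>m. of_int (chi8 m) * q ^ (m ^ 2)) has_sum (q * ?S)) {1..}"
    proof (rule has_sum_theta_squares[OF q, where c = 4])
      show "(theta_term ((- 1) * q ^ 8) ((- 1) * q ^ 24) has_sum ?S) UNIV"
        using theta_neg_1_neg_3[of "q ^ 8"] q qn by (simp flip: power_mult)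
      show "of_int (chi8 (nat \<bar>int 4 * n - 1\<bar>)) = theta_term (- 1) (- 1) n" for n
        by (simp add: chi8_4_minus_1 theta_term_neg_neg)
      show "chi8 m = 0"
        if "m mod 4 \<noteq> 1" "m mod 4 \<noteq> 4 - 1" for m
        using even_if_mod_4[of m] that by (simp add: chi8_def)
    qed simp_all
    hence "((\<lambda>m. of_int (kronecker 2 m) * q ^ (m ^ 2)) has_sum (q * ?S)) {1..}"
      by (rule has_sum_cong[THEN iffD1, rotated]) (simp add: kronecker_2)
    \<comment> \<open>The exponents of \<open>e\<close> add up to \<open>8 + 32 - 16 = 24\<close>,
      which accounts for the extra factor \<open>q\<close>. The same total 24 occurs in all the
      remaining identities.\<close>
    moreover have "q = e ^ 8 * e ^ 32 / e ^ 16"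
      unfolding qe using e by (simp add: field_simps flip: power_mult power_add)
    hence "q * ?S = (e ^ 8 * e ^ 32 / e ^ 16) * ?S"
      by (rule arg_cong[where f = "\<lambda>x. x * ?S"])
    moreover have "(e ^ 8 * e ^ 32 / e ^ 16) * ?S =
        (dedekind_eta (8 * \<tau>) * dedekind_eta (32 * \<tau>) / dedekind_eta (16 * \<tau>))"
      unfolding eta power_mult_distrib times_divide_times_eq by (simp only: mult_ac)
    ultimately show ?thesis by simp
  qed

  have 3: "((\<lambda>n::nat. of_int (kronecker (int n) 2) ^ 2 * q ^ (n ^ 2)) has_sum
       (dedekind_eta (16 * \<tau>) ^ 2 / dedekind_eta (8 * \<tau>))) {1..}"
  proof -
    let ?S = "euler_phi (q ^ 16) ^ 2 / euler_phi (q ^ 8)"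
    have "((\<lambda>m. of_int (if even m then 0 else 1) * q ^ (m ^ 2)) has_sum (q * ?S)) {1..}"
    proof (rule has_sum_theta_squares[OF q, where c = 4])
      show "(theta_term (1 * q ^ 8) (1 * q ^ 24) has_sum ?S) UNIV"
        using theta_1_3[of "q ^ 8"] q qn by (simp flip: power_mult)
      show "of_int (if even (nat \<bar>int 4 * n - 1\<bar>) then 0 else 1) = theta_term 1 1 n" for n
        by (simp add: theta_term_one even_nat_iff)
      show "(if even m then 0 else 1) = (0 :: int)"
        if "m mod 4 \<noteq> 1" "m mod 4 \<noteq> 4 - 1" for m :: nat
        using even_if_mod_4[of m] that by simp
    qed simp_all
    hence "((\<lambda>m. of_int (kronecker (int m) 2 ^ 2) * q ^ (m ^ 2)) has_sum (q * ?S)) {1..}"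
      by (rule has_sum_cong[THEN iffD1, rotated]) (simp add: kronecker_at_2)
    moreover have "q = (e ^ 16) ^ 2 / e ^ 8"
      unfolding qe using e by (simp add: field_simps flip: power_mult power_add)
    hence "q * ?S = ((e ^ 16) ^ 2 / e ^ 8) * ?S"
      by (rule arg_cong[where f = "\<lambda>x. x * ?S"])
    moreover have "((e ^ 16) ^ 2 / e ^ 8) * ?S =
        (dedekind_eta (16 * \<tau>) ^ 2 / dedekind_eta (8 * \<tau>))"
      unfolding eta power_mult_distrib times_divide_times_eq by (simp only: mult_ac)
    ultimately show ?thesis by simp
  qed

  have 4: "((\<lambda>n::nat. of_int (kronecker (int n) 3) ^ 2 * q ^ (n ^ 2)) has_sum
       (dedekind_eta (6 * \<tau>) ^ 2 * dedekind_eta (9 * \<tau>) * dedekind_eta (36 * \<tau>) /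
        (dedekind_eta (3 * \<tau>) * dedekind_eta (12 * \<tau>) * dedekind_eta (18 * \<tau>)))) {1..}"
  proof -
    let ?S = "euler_phi (q ^ 6) ^ 2 * euler_phi (q ^ 9) * euler_phi (q ^ 36) /
       (euler_phi (q ^ 3) * euler_phi (q ^ 12) * euler_phi (q ^ 18))"
    have "((\<lambda>m. of_int (if m mod 3 = 0 then 0 else 1) * q ^ (m ^ 2)) has_sum (q * ?S)) {1..}"
    proof (rule has_sum_theta_squares[OF q, where c = 3])
      show "(theta_term (1 * q ^ 3) (1 * q ^ 15) has_sum ?S) UNIV"
        using theta_1_5[of "q ^ 3"] q qn by (simp flip: power_mult)
      show "of_int (if nat \<bar>int 3 * n - 1\<bar> mod 3 = 0 then 0 else 1) = theta_term 1 1 n" for n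
        using nat_abs_3_minus_1_mod_3[of n] by (simp add: theta_term_one)
      show "(if m mod 3 = 0 then 0 else 1) = (0 :: int)"
        if "m mod 3 \<noteq> 1" "m mod 3 \<noteq> 3 - 1" for m :: nat
        using eq_0_if_mod_3[of m] that by simp
    qed simp_all
    hence "((\<lambda>m. of_int (kronecker (int m) 3 ^ 2) * q ^ (m ^ 2)) has_sum (q * ?S)) {1..}"
      by (rule has_sum_cong[THEN iffD1, rotated]) (simp add: kronecker_at_3)
    moreover have "q = (e ^ 6) ^ 2 * e ^ 9 * e ^ 36 / (e ^ 3 * e ^ 12 * e ^ 18)"
      unfolding qe using e by (simp add: field_simps flip: power_mult power_add)
    hence "q * ?S = ((e ^ 6) ^ 2 * e ^ 9 * e ^ 36 / (e ^ 3 * e ^ 12 * e ^ 18)) * ?S"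
      by (rule arg_cong[where f = "\<lambda>x. x * ?S"])
    moreover have "((e ^ 6) ^ 2 * e ^ 9 * e ^ 36 / (e ^ 3 * e ^ 12 * e ^ 18)) * ?S =
        (dedekind_eta (6 * \<tau>) ^ 2 * dedekind_eta (9 * \<tau>) * dedekind_eta (36 * \<tau>) /
        (dedekind_eta (3 * \<tau>) * dedekind_eta (12 * \<tau>) * dedekind_eta (18 * \<tau>)))"
      unfolding eta power_mult_distrib times_divide_times_eq by (simp only: mult_ac)
    ultimately show ?thesis by simp
  qed

  have 5: "((\<lambda>n::nat. of_int (kronecker 12 n) * q ^ (n ^ 2)) has_sum
       dedekind_eta (24 * \<tau>)) {1..}"
  proof -
    let ?S = "euler_phi (q ^ 24)"
    have "((\<lambda>m. of_int (chi12 m) * q ^ (m ^ 2)) has_sum (q * ?S)) {1..}"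
    proof (rule has_sum_theta_squares[OF q, where c = 6])
      show "(theta_term ((- 1) * q ^ 24) ((- 1) * q ^ 48) has_sum ?S) UNIV"
        using theta_neg_1_neg_2[of "q ^ 24"] q qn by (simp flip: power_mult)
      show "of_int (chi12 (nat \<bar>int 6 * n - 1\<bar>)) = theta_term (- 1) (- 1) n" for n
        by (simp add: chi12_6_minus_1 theta_term_neg_neg)
      show "chi12 m = 0"
        if "m mod 6 \<noteq> 1" "m mod 6 \<noteq> 6 - 1" for m
        using that by (rule chi12_eq_0_mod_6)
    qed simp_all
    hence "((\<lambda>m. of_int (kronecker 12 m) * q ^ (m ^ 2)) has_sum (q * ?S)) {1..}"
      by (rule has_sum_cong[THEN iffD1, rotated]) (simp add: kronecker_12)
    moreover have "q = e ^ 24"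
      unfolding qe using e by (simp add: field_simps flip: power_mult power_add)
    hence "q * ?S = (e ^ 24) * ?S"
      by (rule arg_cong[where f = "\<lambda>x. x * ?S"])
    moreover have "(e ^ 24) * ?S =
        dedekind_eta (24 * \<tau>)"
      unfolding eta power_mult_distrib times_divide_times_eq by (simp only: mult_ac)
    ultimately show ?thesis by simp
  qed

  have 6: "((\<lambda>n::nat. of_int (kronecker 24 n) * q ^ (n ^ 2)) has_sum
       (dedekind_eta (48 * \<tau>) ^ 3 / (dedekind_eta (24 * \<tau>) * dedekind_eta (96 * \<tau>)))) {1..}"
  proof -
    let ?S = "euler_phi (q ^ 48) ^ 3 / (euler_phi (q ^ 24) * euler_phi (q ^ 96))"
    have "((\<lambda>m. of_int (chi12 m * chi8 m) * q ^ (m ^ 2)) has_sum (q * ?S)) {1..}"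
    proof (rule has_sum_theta_squares[OF q, where c = 6])
      show "(theta_term (1 * q ^ 24) ((- 1) * q ^ 48) has_sum ?S) UNIV"
        using theta_1_neg_2[of "q ^ 24"] q qn by (simp flip: power_mult)
      \<comment> \<open>The sign of period 2 from \<open>chi12\<close> times the sign of period 4
        from \<open>chi8\<close> is the pattern of \<open>f(1, - 1)\<close>.\<close>
      show "of_int (chi12 (nat \<bar>int 6 * n - 1\<bar>) * chi8 (nat \<bar>int 6 * n - 1\<bar>)) = theta_term 1 (- 1) n" for n
        by (simp add: chi12_chi8_6_minus_1 theta_term_pos_neg del: of_int_mult)
      show "chi12 m * chi8 m = 0"
        if "m mod 6 \<noteq> 1" "m mod 6 \<noteq> 6 - 1" for m
        using chi12_eq_0_mod_6[of m] that by simp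
    qed simp_all
    hence "((\<lambda>m. of_int (kronecker 24 m) * q ^ (m ^ 2)) has_sum (q * ?S)) {1..}"
      by (rule has_sum_cong[THEN iffD1, rotated]) (simp add: kronecker_24)
    moreover have "q = (e ^ 48) ^ 3 / (e ^ 24 * e ^ 96)"
      unfolding qe using e by (simp add: field_simps flip: power_mult power_add)
    hence "q * ?S = ((e ^ 48) ^ 3 / (e ^ 24 * e ^ 96)) * ?S"
      by (rule arg_cong[where f = "\<lambda>x. x * ?S"])
    moreover have "((e ^ 48) ^ 3 / (e ^ 24 * e ^ 96)) * ?S =
        (dedekind_eta (48 * \<tau>) ^ 3 / (dedekind_eta (24 * \<tau>) * dedekind_eta (96 * \<tau>)))"
      unfolding eta power_mult_distrib times_divide_times_eq by (simp only: mult_ac)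
    ultimately show ?thesis by simp
  qed

  have 7: "((\<lambda>n::nat. of_int (kronecker (int n) 6) ^ 2 * q ^ (n ^ 2)) has_sum
       (dedekind_eta (48 * \<tau>) * dedekind_eta (72 * \<tau>) ^ 2 /
        (dedekind_eta (24 * \<tau>) * dedekind_eta (144 * \<tau>)))) {1..}"
  proof -
    let ?S = "euler_phi (q ^ 48) * euler_phi (q ^ 72) ^ 2 /
       (euler_phi (q ^ 24) * euler_phi (q ^ 144))"
    have "((\<lambda>m. of_int (chi12 m ^ 2) * q ^ (m ^ 2)) has_sum (q * ?S)) {1..}"
    proof (rule has_sum_theta_squares[OF q, where c = 6])
      show "(theta_term (1 * q ^ 24) (1 * q ^ 48) has_sum ?S) UNIV"
        using theta_1_2[of "q ^ 24"] q qn by (simp flip: power_mult)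
      show "of_int (chi12 (nat \<bar>int 6 * n - 1\<bar>) ^ 2) = theta_term 1 1 n" for n
        by (simp add: chi12_6_minus_1 theta_term_one)
      show "chi12 m ^ 2 = 0"
        if "m mod 6 \<noteq> 1" "m mod 6 \<noteq> 6 - 1" for m
        using chi12_eq_0_mod_6[of m] that by simp
    qed simp_all
    hence "((\<lambda>m. of_int (kronecker (int m) 6 ^ 2) * q ^ (m ^ 2)) has_sum (q * ?S)) {1..}"
      by (rule has_sum_cong[THEN iffD1, rotated]) (simp add: kronecker_at_6)
    moreover have "q = e ^ 48 * (e ^ 72) ^ 2 / (e ^ 24 * e ^ 144)"
      unfolding qe using e by (simp add: field_simps flip: power_mult power_add)
    hence "q * ?S = (e ^ 48 * (e ^ 72) ^ 2 / (e ^ 24 * e ^ 144)) * ?S"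
      by (rule arg_cong[where f = "\<lambda>x. x * ?S"])
    moreover have "(e ^ 48 * (e ^ 72) ^ 2 / (e ^ 24 * e ^ 144)) * ?S =
        (dedekind_eta (48 * \<tau>) * dedekind_eta (72 * \<tau>) ^ 2 /
        (dedekind_eta (24 * \<tau>) * dedekind_eta (144 * \<tau>)))"
      unfolding eta power_mult_distrib times_divide_times_eq by (simp only: mult_ac)
    ultimately show ?thesis by simp
  qed

  have 8: "((\<lambda>n::nat. of_int (kronecker 18 n) * q ^ (n ^ 2)) has_sum
       (dedekind_eta (24 * \<tau>) * dedekind_eta (96 * \<tau>) * dedekind_eta (144 * \<tau>) ^ 5 /
        (dedekind_eta (48 * \<tau>) ^ 2 * dedekind_eta (72 * \<tau>) ^ 2 * dedekind_eta (288 * \<tau>) ^ 2))) {1..}"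
  proof -
    let ?S = "euler_phi (q ^ 24) * euler_phi (q ^ 96) * euler_phi (q ^ 144) ^ 5 /
       (euler_phi (q ^ 48) ^ 2 * euler_phi (q ^ 72) ^ 2 * euler_phi (q ^ 288) ^ 2)"
    have "((\<lambda>m. of_int (chi12 m ^ 2 * chi8 m) * q ^ (m ^ 2)) has_sum (q * ?S)) {1..}"
    proof (rule has_sum_theta_squares[OF q, where c = 6])
      show "(theta_term ((- 1) * q ^ 24) (1 * q ^ 48) has_sum ?S) UNIV"
        using theta_neg_1_2[of "q ^ 24"] q qn by (simp flip: power_mult)
      \<comment> \<open>Squaring removes the sign of \<open>chi12\<close>, so the pattern is that of
        \<open>chi8\<close> alone.\<close>
      show "of_int (chi12 (nat \<bar>int 6 * n - 1\<bar>) ^ 2 * chi8 (nat \<bar>int 6 * n - 1\<bar>)) = theta_term (- 1) 1 n" for n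
        by (simp add: chi12_6_minus_1 chi8_6_minus_1 theta_term_neg_pos)
      show "chi12 m ^ 2 * chi8 m = 0"
        if "m mod 6 \<noteq> 1" "m mod 6 \<noteq> 6 - 1" for m
        using chi12_eq_0_mod_6[of m] that by simp
    qed simp_all
    hence "((\<lambda>m. of_int (kronecker 18 m) * q ^ (m ^ 2)) has_sum (q * ?S)) {1..}"
      by (rule has_sum_cong[THEN iffD1, rotated]) (simp add: kronecker_18)
    moreover have "q = e ^ 24 * e ^ 96 * (e ^ 144) ^ 5 / ((e ^ 48) ^ 2 * (e ^ 72) ^ 2 * (e ^ 288) ^ 2)"
      unfolding qe using e by (simp add: field_simps flip: power_mult power_add)
    hence "q * ?S = (e ^ 24 * e ^ 96 * (e ^ 144) ^ 5 / ((e ^ 48) ^ 2 * (e ^ 72) ^ 2 * (e ^ 288) ^ 2)) * ?S"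
      by (rule arg_cong[where f = "\<lambda>x. x * ?S"])
    moreover have "(e ^ 24 * e ^ 96 * (e ^ 144) ^ 5 / ((e ^ 48) ^ 2 * (e ^ 72) ^ 2 * (e ^ 288) ^ 2)) * ?S =
        (dedekind_eta (24 * \<tau>) * dedekind_eta (96 * \<tau>) * dedekind_eta (144 * \<tau>) ^ 5 /
        (dedekind_eta (48 * \<tau>) ^ 2 * dedekind_eta (72 * \<tau>) ^ 2 * dedekind_eta (288 * \<tau>) ^ 2))"
      unfolding eta power_mult_distrib times_divide_times_eq by (simp only: mult_ac)
    ultimately show ?thesis by simp
  qed

  from 1 2 3 4 5 6 7 8 show ?thesis by blast
qed

end
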